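(* Let $K$ be a field and let $G$ be one of the following graphs: (1) a path graph; (2) a biclique graph; (3) a Cameron--Walker graph whose bipartite graph is a complete bipartite graph. Then all powers $I_G^k$ ($k\ge1$) of the vertex cover ideal $I_G$ of $G$ have linear quotients and are therefore componentwise linear.
   Context: For a finite simple graph $G$, $S$ denotes the polynomial ring over $K$ whose variables are the vertices of $G$; the vertex cover ideal $I_G\subset S$ is generated by the monomials $\prod_{v\in C}v$, where $C$ ranges over the minimal vertex covers of $G$. A path graph is the graph on $\{1,\ldots,n\}$ with edges $\{1,2\},\{2,3\},\ldots,\{n-1,n\}$. A biclique graph is a graph $\Gamma_{p,q,r}$ ($p,q,r\ge1$) on $\{x_1,\ldots,x_p,y_1,\ldots,y_q,z_1,\ldots,z_r\}$ that is the union of the complete graph on $\{x_1,\ldots,x_p,y_1,\ldots,y_q\}$ and the complete graph on $\{x_1,\ldots,x_p,z_1,\ldots,z_r\}$. A Cameron--Walker graph consists of a connected bipartite graph with vertex partition $V_1\cup V_2$, $V_1,V_2\neq\emptyset$, such that at least one leaf edge is attached to each vertex of $V_1$ and possibly some (zero or more) pendant triangles are attached to each vertex of $V_2$; in (3) the bipartite graph on $V_1\cup V_2$ is the complete bipartite graph. A graded ideal $I\subset S$ has linear quotients if it has a system of generators $g_1,\ldots,g_r$ such that for each $j$ the ideal $(g_1,\ldots,g_{j-1}):g_j$ is either $S$ or generated by linear forms (the zero ideal is allowed). For a graded $S$-module $M$, $M_{\langle k\rangle}$ is the submodule generated by all elements of degree $k$; $M$ is componentwise linear if $M_{\langle k\rangle}$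 has a linear resolution for every $k$. *)

theory Defs
  imports "HOL-Library.Poly_Mapping" "Jordan_Normal_Form.Matrix_Kernel"
begin

text \<open>
  A graph is given by its vertex type \<open>'v\<close> (all elements are vertices, \<open>'v\<close> will be
  of class \<open>finite\<close>) and its set of edges, each edge being a two-element set.
  \<open>('v, 'k) mpoly\<close> is then the polynomial ring over \<open>'k\<close> whose variables are
  exactly the vertices: finitely supported maps from exponent vectors to coefficients.
\<close>

type_synonym ('v, 'k) mpoly = "('v \<Rightarrow>\<^sub>0 nat) \<Rightarrow>\<^sub>0 'k"

definition var :: "'v \<Rightarrow> ('v, 'k::comm_ring_1) mpoly" where
  "var v = Poly_Mapping.single (Poly_Mapping.single v 1) 1"

definition mon_degree :: "('v \<Rightarrow>\<^sub>0 nat) \<Rightarrow> nat" where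
  "mon_degree m = (\<Sum>v\<in>Poly_Mapping.keys m. Poly_Mapping.lookup m v)"

text \<open>The zero polynomial is homogeneous of every degree.\<close>

definition homogeneous :: "nat \<Rightarrow> ('v, 'k::zero) mpoly \<Rightarrow> bool" where
  "homogeneous d p \<longleftrightarrow> (\<forall>m\<in>Poly_Mapping.keys p. mon_degree m = d)"


section \<open>Ideals\<close>

text \<open>Ideals are the submodules of the ring viewed as a module over itself.\<close>

lemma module_times: "Modules.module ((*) :: 'a::comm_ring_1 \<Rightarrow> 'a \<Rightarrow> 'a)"
  by unfold_locales (auto simp: algebra_simps)

definition ideal_gen :: "'a::comm_ring_1 set \<Rightarrow> 'a set" where
  "ideal_gen B = Modules.module.span (*) B"

definition ideal_mult :: "'a::comm_ring_1 set \<Rightarrow> 'a set \<Rightarrow> 'a set" where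
  "ideal_mult I J = ideal_gen {f * g | f g. f \<in> I \<and> g \<in> J}"

primrec ideal_power :: "'a::comm_ring_1 set \<Rightarrow> nat \<Rightarrow> 'a set" where
  "ideal_power I 0 = UNIV"
| "ideal_power I (Suc k) = ideal_mult I (ideal_power I k)"

definition colon :: "'a::comm_ring_1 set \<Rightarrow> 'a \<Rightarrow> 'a set" where
  "colon I g = {f. f * g \<in> I}"

definition generated_by_linear_forms :: "('v, 'k::comm_ring_1) mpoly set \<Rightarrow> bool" where
  "generated_by_linear_forms I \<longleftrightarrow> (\<exists>L. (\<forall>l\<in>L. homogeneous 1 l) \<and> I = ideal_gen L)"

text \<open>As we are in the graded category, the system of generators is homogeneous.\<close>

definition has_linear_quotients :: "('v, 'k::comm_ring_1) mpoly set \<Rightarrow> bool" where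
  "has_linear_quotients I \<longleftrightarrow>
    (\<exists>gs. (\<forall>g\<in>set gs. \<exists>d. homogeneous d g) \<and> I = ideal_gen (set gs) \<and>
      (\<forall>j<length gs. let Q = colon (ideal_gen (set (take j gs))) (gs ! j) in
         Q = UNIV \<or> generated_by_linear_forms Q))"


section \<open>Linear resolutions and componentwise linearity\<close>

text \<open>
  A linear resolution of a graded ideal \<open>M\<close> of \<open>S\<close> is an exact complex
  \[ \cdots \to S(-d-2)^{b_2} \to S(-d-1)^{b_1} \to S(-d)^{b_0} \to M \to 0 \]
  with homogeneous maps of degree \<open>0\<close>.  The map out of \<open>S(-d-i)\<^sup>b\<close>, \<open>b = b i\<close>, is the matrix
  \<open>A i\<close>: the single row \<open>A 0\<close> holds forms of degree \<open>d\<close>, and the matrices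
  \<open>A (Suc i)\<close> hold linear forms.  Such a resolution is automatically minimal,
  since linear forms lie in the graded maximal ideal.
\<close>

definition has_linear_resolution :: "('v, 'k::comm_ring_1) mpoly set \<Rightarrow> bool" where
  "has_linear_resolution M \<longleftrightarrow>
    (\<exists>d (b :: nat \<Rightarrow> nat) (A :: nat \<Rightarrow> ('v, 'k) mpoly mat).
      A 0 \<in> carrier_mat 1 (b 0) \<and>
      (\<forall>p\<in>elements_mat (A 0). homogeneous d p) \<and>
      {(A 0 *\<^sub>v u) $ 0 | u. u \<in> carrier_vec (b 0)} = M \<and>
      (\<forall>i. A (Suc i) \<in> carrier_mat (b i) (b (Suc i)) \<and>
           (\<forall>p\<in>elements_mat (A (Suc i)). homogeneous 1 p) \<and>
           mat_kernel (A i) = (\<lambda>u. A (Suc i) *\<^sub>v u) ` carrier_vec (b (Suc i))))"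

definition degree_component_ideal ::
    "('v, 'k::comm_ring_1) mpoly set \<Rightarrow> nat \<Rightarrow> ('v, 'k) mpoly set" where
  "degree_component_ideal M k = ideal_gen {f \<in> M. homogeneous k f}"

definition componentwise_linear :: "('v, 'k::comm_ring_1) mpoly set \<Rightarrow> bool" where
  "componentwise_linear M \<longleftrightarrow> (\<forall>k. has_linear_resolution (degree_component_ideal M k))"


section \<open>Vertex cover ideals\<close>

definition vertex_cover :: "'v set set \<Rightarrow> 'v set \<Rightarrow> bool" where
  "vertex_cover E C \<longleftrightarrow> (\<forall>e\<in>E. e \<inter> C \<noteq> {})"

definition minimal_vertex_cover :: "'v set set \<Rightarrow> 'v set \<Rightarrow> bool" where
  "minimal_vertex_cover E C \<longleftrightarrow> vertex_cover E C \<and> (\<forall>D. D \<subset> C \<longrightarrow> \<not> vertex_cover E D)"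

definition vertex_cover_ideal :: "'v set set \<Rightarrow> ('v, 'k::comm_ring_1) mpoly set" where
  "vertex_cover_ideal E = ideal_gen {\<Prod>v\<in>C. var v | C. minimal_vertex_cover E C}"


section \<open>The graph classes, up to relabelling of the vertices\<close>

definition path_graph :: "'v set set \<Rightarrow> bool" where
  "path_graph E \<longleftrightarrow>
    (\<exists>(n::nat) f. bij_betw f {1..n} (UNIV :: 'v set) \<and> E = {{f i, f (i + 1)} | i. 1 \<le> i \<and> i < n})"

definition complete_edges :: "'v set \<Rightarrow> 'v set set" where
  "complete_edges W = {{u, v} | u v. u \<in> W \<and> v \<in> W \<and> u \<noteq> v}"

definition complete_bipartite_edges :: "'v set \<Rightarrow> 'v set \<Rightarrow> 'v set set" where
  "complete_bipartite_edges V1 V2 = {{u, v} | u v. u \<in> V1 \<and> v \<in> V2}"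

definition biclique_graph :: "'v set set \<Rightarrow> bool" where
  "biclique_graph E \<longleftrightarrow>
    (\<exists>X Y Z. X \<noteq> {} \<and> Y \<noteq> {} \<and> Z \<noteq> {} \<and>
       X \<inter> Y = {} \<and> X \<inter> Z = {} \<and> Y \<inter> Z = {} \<and> X \<union> Y \<union> Z = (UNIV :: 'v set) \<and>
       E = complete_edges (X \<union> Y) \<union> complete_edges (X \<union> Z))"

definition connected_bipartite :: "'v set \<Rightarrow> 'v set \<Rightarrow> 'v set set \<Rightarrow> bool" where
  "connected_bipartite V1 V2 B \<longleftrightarrow>
    V1 \<inter> V2 = {} \<and> B \<subseteq> complete_bipartite_edges V1 V2 \<and>
    (\<forall>u\<in>V1 \<union> V2. \<forall>v\<in>V1 \<union> V2. (u, v) \<in> {(x, y). {x, y} \<in> B}\<^sup>*)"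

text \<open>
  \<open>L\<close> is the set of leaves outside the bipartite graph, the leaf \<open>l\<close> being attached to
  \<open>a l\<close>.  Each member of \<open>P\<close> is the pair of new vertices of a pendant triangle, the
  triangle with new vertices \<open>e\<close> being attached to \<open>t e\<close>.
\<close>

definition cameron_walker_graph :: "'v set \<Rightarrow> 'v set \<Rightarrow> 'v set set \<Rightarrow> 'v set set \<Rightarrow> bool" where
  "cameron_walker_graph V1 V2 B E \<longleftrightarrow>
    V1 \<noteq> {} \<and> V2 \<noteq> {} \<and> connected_bipartite V1 V2 B \<and>
    (\<exists>L a P t.
       (V1 \<union> V2) \<inter> L = {} \<and> (V1 \<union> V2) \<inter> \<Union>P = {} \<and> L \<inter> \<Union>P = {} \<and>
       V1 \<union> V2 \<union> L \<union> \<Union>P = UNIV \<and>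
       a ` L = V1 \<and>
       (\<forall>e\<in>P. card e = 2 \<and> t e \<in> V2) \<and> pairwise disjnt P \<and>
       E = B \<union> {{a l, l} | l. l \<in> L} \<union> P \<union> {{t e, w} | e w. e \<in> P \<and> w \<in> e})"

end

theory Submission
  imports Defs
begin

text \<open>
  A monomial lies in \<open>I\<^sub>G\<^sup>k\<close> if and only if there are \<open>k\<close> vertex covers such that every vertex \<open>v\<close>
  lies in at most \<open>a v\<close> of them, where \<open>a\<close> is the exponent (\<open>power_vertex_cover_ideal\<close>).  Look at the
  deficits \<open>k - a v\<close>, cut off at zero.  Since a vertex cover misses at most one vertex of a
  clique, the deficits on a clique add up to at most \<open>k\<close>.  For the three families of graphs
  this necessary condition is also sufficient, as explicit constructions of covers show.  So the
  exponents of \<open>I\<^sub>G\<^sup>k\<close> are described by inequalities, one for each clique.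

  Order the vertices and compare exponents lexicographically.  If \<open>u\<close> comes before \<open>v\<close>
  and does not divide it, one can move a unit of \<open>v\<close> from some vertex \<open>r\<close> to a later vertex \<open>s\<close> with
  \<open>v s < u s\<close> without leaving the ideal.  The obstacles are the clique inequalities that are
  tight for \<open>v\<close>; for suitable orders of the vertices one vertex \<open>s\<close> deals with all of
  them, except at the vertices in \<open>V1\<close> of a Cameron--Walker graph, where a unit can be taken from a
  leaf (\<open>clique_bounded_exchange\<close>).

  This exchange property makes the lexicographic order an order of linear quotients, with
  colon ideals generated by variables, for two sets of monomials in the ideal: for the
  minimal generators, which gives the first claim, and for all monomials of a fixed degree
  (\<open>exchange_imp_variable_quotients\<close>).  The latter generate the component ideal of that degree, and
  it remains to see that linear quotients in a single degree give a linear resolution.  The reason is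
  that vectors in a free module with colon ideals generated by variables have a system of
  syzygies with linear entries and again with colon ideals generated by variables
  (\<open>syzygies_have_linear_quotients\<close>), so the argument can be repeated forever.
\<close>

section \<open>Monomial ideals\<close>

text \<open>Exponent vectors are plain functions: the set of variables is finite, so every function
  \<open>'v \<Rightarrow> nat\<close> is the exponent of a monomial, and divisibility of monomials becomes the
  pointwise order.\<close>

definition monomial :: "('v::finite \<Rightarrow> nat) \<Rightarrow> ('v, 'k::comm_ring_1) mpoly" where
  "monomial a = Poly_Mapping.single (Abs_poly_mapping a) 1"

text \<open>For an up-closed \<open>U\<close> this is the monomial ideal with exponent set \<open>U\<close>.  Other sets \<open>U\<close> are
  used as well: with the exponents of degree \<open>d\<close> one gets the forms of degree \<open>d\<close>.\<close>

definition supported :: "('v \<Rightarrow> nat) set \<Rightarrow> ('v, 'k::zero) mpoly set" where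
  "supported U = {p. \<forall>m\<in>Poly_Mapping.keys p. Poly_Mapping.lookup m \<in> U}"

definition up_closure :: "('v \<Rightarrow> nat) set \<Rightarrow> ('v \<Rightarrow> nat) set" where
  "up_closure A = {b. \<exists>a\<in>A. a \<le> b}"

definition up_closed :: "('v \<Rightarrow> nat) set \<Rightarrow> bool" where
  "up_closed U \<longleftrightarrow> (\<forall>a\<in>U. \<forall>b. a \<le> b \<longrightarrow> b \<in> U)"

definition unit_exp :: "'v \<Rightarrow> 'v \<Rightarrow> nat" where
  "unit_exp x = (\<lambda>v. if v = x then 1 else 0)"

lemma up_closed_up_closure: "up_closed (up_closure A)"
  unfolding up_closed_def up_closure_def by (blast intro: order_trans)

lemma lookup_Abs [simp]: "Poly_Mapping.lookup (Abs_poly_mapping (a :: 'v::finite \<Rightarrow> nat)) = a"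
  by simp

lemma Abs_poly_mapping_add:
  fixes a b :: "'v::finite \<Rightarrow> nat"
  shows "Abs_poly_mapping a + Abs_poly_mapping b = Abs_poly_mapping (\<lambda>v. a v + b v)"
  by (rule poly_mapping_eqI) (simp add: lookup_add)

lemma monomial_mult: "monomial a * monomial b = monomial (\<lambda>v. a v + b v)"
  by (simp add: monomial_def mult_single Abs_poly_mapping_add)

lemma var_eq_monomial: "var x = monomial (unit_exp x)"
proof -
  have "Poly_Mapping.single x 1 = Abs_poly_mapping (unit_exp x)"
    by (rule poly_mapping_eqI) (simp add: lookup_single unit_exp_def when_def)
  then show ?thesis by (simp add: var_def monomial_def)
qed

lemma keys_monomial [simp]: "Poly_Mapping.keys (monomial a) = {Abs_poly_mapping a}"
  by (simp add: monomial_def)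

lemma monomial_in_supported: "a \<in> U \<Longrightarrow> monomial a \<in> supported U"
  by (simp add: supported_def)

lemma homogeneous_iff_supported:
  "homogeneous d (p :: ('v::finite, 'k::zero) mpoly) \<longleftrightarrow> p \<in> supported {a. sum a UNIV = d}"
proof -
  have "mon_degree m = sum (Poly_Mapping.lookup m) UNIV" for m :: "'v \<Rightarrow>\<^sub>0 nat"
    unfolding mon_degree_def by (rule sum.mono_neutral_left) (auto simp: in_keys_iff)
  then show ?thesis by (simp add: homogeneous_def supported_def)
qed

lemma supported_zero [simp]: "0 \<in> supported U"
  by (simp add: supported_def)

lemma supported_add: "p \<in> supported U \<Longrightarrow> q \<in> supported U \<Longrightarrow> p + q \<in> supported U"
  using keys_add[of p q] unfolding supported_def by blast

lemma supported_uminus: "p \<in> supported U \<Longrightarrow> - p \<in> supported U"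
  for p :: "('v, 'k::comm_ring_1) mpoly"
  unfolding supported_def by (simp add: in_keys_iff)

lemma supported_diff: "p \<in> supported U \<Longrightarrow> q \<in> supported U \<Longrightarrow> p - q \<in> supported U"
  for p :: "('v, 'k::comm_ring_1) mpoly"
  using supported_add[of p U "- q"] supported_uminus[of q U] by simp

lemma supported_sum: "(\<And>i. i \<in> I \<Longrightarrow> f i \<in> supported U) \<Longrightarrow> sum f I \<in> supported U"
  by (induction I rule: infinite_finite_induct) (auto intro: supported_add)

lemma supported_disjoint:
  "p \<in> supported U \<Longrightarrow> p \<in> supported W \<Longrightarrow> U \<inter> W = {} \<Longrightarrow> p = 0"
  for p :: "('v, 'k::comm_ring_1) mpoly"
proof -
  assume "p \<in> supported U" "p \<in> supported W" "U \<inter> W = {}"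
  then have "Poly_Mapping.keys p = {}" unfolding supported_def by blast
  then show "p = 0" by (intro poly_mapping_eqI) (simp add: in_keys_iff[symmetric])
qed

lemma supported_mult:
  fixes p q :: "('v, 'k::comm_ring_1) mpoly"
  assumes "p \<in> supported U" "q \<in> supported W"
    and "\<And>a b. a \<in> U \<Longrightarrow> b \<in> W \<Longrightarrow> (\<lambda>v. a v + b v) \<in> Z"
  shows "p * q \<in> supported Z"
proof -
  have "Poly_Mapping.lookup m \<in> Z" if m: "m \<in> Poly_Mapping.keys (p * q)" for m
  proof -
    obtain a b where "m = a + b" "a \<in> Poly_Mapping.keys p" "b \<in> Poly_Mapping.keys q"
      using subsetD[OF keys_mult m] by auto
    moreover have "Poly_Mapping.lookup (a + b) = (\<lambda>v. Poly_Mapping.lookup a v + Poly_Mapping.lookup b v)"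
      by (rule ext) (simp add: lookup_add)
    ultimately show ?thesis using assms unfolding supported_def by simp
  qed
  then show ?thesis by (simp add: supported_def)
qed

lemma sum_of_terms: "p = (\<Sum>m\<in>Poly_Mapping.keys p. Poly_Mapping.single m (Poly_Mapping.lookup p m))"
proof (rule poly_mapping_eqI)
  fix k
  show "Poly_Mapping.lookup p k =
    Poly_Mapping.lookup (\<Sum>m\<in>Poly_Mapping.keys p. Poly_Mapping.single m (Poly_Mapping.lookup p m)) k"
    by (simp add: lookup_sum lookup_single when_def in_keys_iff)
qed

text \<open>Sorting the terms of \<open>p\<close> by their exponents.  The lemma serves to cut homogeneous parts out
  of polynomials.\<close>

lemma supported_split:
  fixes p :: "('v, 'k::comm_ring_1) mpoly"
  obtains q r where "p = q + r" "q \<in> supported U" "r \<in> supported (- U)"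
proof -
  let ?t = "\<lambda>m. Poly_Mapping.single m (Poly_Mapping.lookup p m)"
  let ?A = "{m \<in> Poly_Mapping.keys p. Poly_Mapping.lookup m \<in> U}"
  let ?B = "{m \<in> Poly_Mapping.keys p. Poly_Mapping.lookup m \<in> - U}"
  have "p = sum ?t (?A \<union> ?B)"
  proof -
    have "?A \<union> ?B = Poly_Mapping.keys p" by blast
    then have "sum ?t (?A \<union> ?B) = sum ?t (Poly_Mapping.keys p)" by (rule arg_cong)
    then show ?thesis by (rule trans[OF sum_of_terms[of p] sym])
  qed
  also have "\<dots> = sum ?t ?A + sum ?t ?B"
    by (rule sum.union_disjoint) auto
  finally have "p = sum ?t ?A + sum ?t ?B" .
  moreover have "sum ?t ?A \<in> supported U" "sum ?t ?B \<in> supported (- U)"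
    by (intro supported_sum; simp add: supported_def)+
  ultimately show ?thesis using that by blast
qed

lemma lookup_mult_monomial:
  fixes p :: "('v::finite, 'k::comm_ring_1) mpoly"
  shows "Poly_Mapping.lookup (p * monomial a) (m + Abs_poly_mapping a) = Poly_Mapping.lookup p m"
proof -
  have "p * monomial a = (\<Sum>k\<in>Poly_Mapping.keys p. Poly_Mapping.single (k + Abs_poly_mapping a) (Poly_Mapping.lookup p k))"
    using arg_cong[OF sum_of_terms[of p], of "\<lambda>q. q * monomial a"]
    unfolding sum_distrib_right monomial_def mult_single by simp
  then show ?thesis
    by (simp add: lookup_sum lookup_single when_def in_keys_iff)
qed

text \<open>Multiplication by a monomial shifts the exponents injectively, so no terms can cancel.  This
  turns colon ideals of monomial ideals into conditions on exponents.\<close>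

lemma mult_monomial_in_supported_iff:
  fixes p :: "('v::finite, 'k::comm_ring_1) mpoly"
  shows "p * monomial a \<in> supported W \<longleftrightarrow> p \<in> supported {b. (\<lambda>v. b v + a v) \<in> W}"
proof
  assume "p \<in> supported {b. (\<lambda>v. b v + a v) \<in> W}"
  then show "p * monomial a \<in> supported W"
    by (rule supported_mult[OF _ monomial_in_supported[of a "{a}"]]) auto
next
  assume *: "p * monomial a \<in> supported W"
  show "p \<in> supported {b. (\<lambda>v. b v + a v) \<in> W}"
    unfolding supported_def
  proof (intro CollectI ballI)
    fix m assume "m \<in> Poly_Mapping.keys p"
    then have "m + Abs_poly_mapping a \<in> Poly_Mapping.keys (p * monomial a)"
      by (simp add: in_keys_iff lookup_mult_monomial)
    then have "Poly_Mapping.lookup (m + Abs_poly_mapping a) \<in> W"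
      using * by (simp add: supported_def)
    moreover have "Poly_Mapping.lookup (m + Abs_poly_mapping a) = (\<lambda>v. Poly_Mapping.lookup m v + a v)"
      by (rule ext) (simp add: lookup_add)
    ultimately show "(\<lambda>v. Poly_Mapping.lookup m v + a v) \<in> W" by simp
  qed
qed

interpretation ring_module: Modules.module "(*) :: 'a::comm_ring_1 \<Rightarrow> 'a \<Rightarrow> 'a"
  by (rule module_times)

lemma subspace_supported:
  fixes U :: "('v::finite \<Rightarrow> nat) set"
  assumes "up_closed U"
  shows "ring_module.subspace (supported U :: ('v, 'k::comm_ring_1) mpoly set)"
proof (rule ring_module.subspaceI)
  fix c p :: "('v, 'k) mpoly" assume "p \<in> supported U"
  moreover have "c \<in> supported UNIV" by (simp add: supported_def)
  moreover have "(\<lambda>v. a v + b v) \<in> U" if "b \<in> U" for a b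
    using assms that unfolding up_closed_def by (simp add: le_fun_def)
  ultimately show "c * p \<in> supported U" by (blast intro: supported_mult)
qed (auto intro: supported_add)

lemma ideal_gen_monomials:
  fixes A :: "('v::finite \<Rightarrow> nat) set"
  shows "ideal_gen (monomial ` A :: ('v, 'k::comm_ring_1) mpoly set) = supported (up_closure A)"
proof
  have "monomial ` A \<subseteq> (supported (up_closure A) :: ('v, 'k) mpoly set)"
    by (auto intro!: monomial_in_supported simp: up_closure_def)
  then show "ideal_gen (monomial ` A) \<subseteq> (supported (up_closure A) :: ('v, 'k) mpoly set)"
    unfolding ideal_gen_def
    by (rule ring_module.span_minimal) (rule subspace_supported[OF up_closed_up_closure])
next
  show "(supported (up_closure A) :: ('v, 'k) mpoly set) \<subseteq> ideal_gen (monomial ` A)"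
  proof
    fix p :: "('v, 'k) mpoly" assume p: "p \<in> supported (up_closure A)"
    have "Poly_Mapping.single m (Poly_Mapping.lookup p m) \<in> ideal_gen (monomial ` A)"
      if "m \<in> Poly_Mapping.keys p" for m
    proof -
      have "Poly_Mapping.lookup m \<in> up_closure A"
        using p that by (simp add: supported_def)
      then obtain a where a: "a \<in> A" "a \<le> Poly_Mapping.lookup m"
        unfolding up_closure_def by (elim CollectE bexE)
      let ?b = "\<lambda>v. Poly_Mapping.lookup m v - a v"
      have "m = Abs_poly_mapping ?b + Abs_poly_mapping a"
      proof (rule poly_mapping_eqI)
        fix k
        show "Poly_Mapping.lookup m k = Poly_Mapping.lookup (Abs_poly_mapping ?b + Abs_poly_mapping a) k"
          unfolding lookup_add lookup_Abs using le_funD[OF a(2), of k] by simp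
      qed
      then have "Poly_Mapping.single m (Poly_Mapping.lookup p m) =
        Poly_Mapping.single (Abs_poly_mapping ?b) (Poly_Mapping.lookup p m) * monomial a"
        by (simp add: monomial_def mult_single)
      then show ?thesis using a(1) unfolding ideal_gen_def
        by (simp add: ring_module.span_base ring_module.span_scale)
    qed
    then show "p \<in> ideal_gen (monomial ` A)"
      unfolding ideal_gen_def by (subst sum_of_terms) (rule ring_module.span_sum)
  qed
qed

section \<open>Ideals generated by variables\<close>

definition var_ideal :: "'v set \<Rightarrow> ('v, 'k::comm_ring_1) mpoly set" where
  "var_ideal X = supported {a. \<exists>x\<in>X. 0 < a x}"

lemma var_ideal_eq_ideal_gen:
  "var_ideal X = (ideal_gen (var ` X) :: ('v::finite, 'k::comm_ring_1) mpoly set)"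
proof -
  have "up_closure (unit_exp ` X) = {a. \<exists>x\<in>X. 0 < a x}"
    unfolding up_closure_def unit_exp_def le_fun_def
    by (auto simp: Suc_le_eq split: if_splits)
  moreover have "var ` X = (monomial ` unit_exp ` X :: ('v, 'k) mpoly set)"
    by (simp add: image_image var_eq_monomial)
  ultimately show ?thesis by (simp add: var_ideal_def ideal_gen_monomials)
qed

lemma var_ideal_generated_by_linear_forms:
  "generated_by_linear_forms (var_ideal X :: ('v::finite, 'k::comm_ring_1) mpoly set)"
proof -
  have "homogeneous 1 (var x :: ('v, 'k) mpoly)" for x
    by (simp add: homogeneous_iff_supported var_eq_monomial supported_def unit_exp_def)
  then show ?thesis
    unfolding generated_by_linear_forms_def var_ideal_eq_ideal_gen by blast
qed

lemma ideal_gen_iff_combination: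
  fixes c :: "'a::comm_ring_1"
  shows "c \<in> ideal_gen (set ys) \<longleftrightarrow> (\<exists>w. c = (\<Sum>b<length ys. w b * ys ! b))"
proof (induction ys arbitrary: c)
  case Nil
  then show ?case by (simp add: ideal_gen_def)
next
  case (Cons y ys)
  have "c \<in> ideal_gen (set (y # ys)) \<longleftrightarrow> (\<exists>k. c - k * y \<in> ideal_gen (set ys))"
    by (simp add: ideal_gen_def ring_module.span_insert)
  also have "\<dots> \<longleftrightarrow> (\<exists>k w. c - k * y = (\<Sum>b<length ys. w b * ys ! b))"
    by (simp only: Cons.IH)
  also have "\<dots> \<longleftrightarrow> (\<exists>w. c = (\<Sum>b<length (y # ys). w b * (y # ys) ! b))"
  proof
    assume "\<exists>k w. c - k * y = (\<Sum>b<length ys. w b * ys ! b)"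
    then obtain k w where "c - k * y = (\<Sum>b<length ys. w b * ys ! b)" by blast
    then have "c = (\<Sum>b<length (y # ys). (case b of 0 \<Rightarrow> k | Suc b' \<Rightarrow> w b') * (y # ys) ! b)"
      by (simp add: sum.lessThan_Suc_shift diff_eq_eq add.commute del: sum.lessThan_Suc)
    then show "\<exists>w. c = (\<Sum>b<length (y # ys). w b * (y # ys) ! b)"
      by (rule exI[where x = "\<lambda>b. case b of 0 \<Rightarrow> k | Suc b' \<Rightarrow> w b'"])
  next
    assume "\<exists>w. c = (\<Sum>b<length (y # ys). w b * (y # ys) ! b)"
    then obtain w where "c = (\<Sum>b<length (y # ys). w b * (y # ys) ! b)" by blast
    then have "c - w 0 * y = (\<Sum>b<length ys. w (Suc b) * ys ! b)"
      by (simp add: sum.lessThan_Suc_shift del: sum.lessThan_Suc)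
    then show "\<exists>k w. c - k * y = (\<Sum>b<length ys. w b * ys ! b)"
      by (intro exI[where x = "w 0"] exI[where x = "\<lambda>b. w (Suc b)"])
  qed
  finally show ?case .
qed

text \<open>Coefficients are indexed by positions in a list because the syzygies built below come in a
  fixed order.\<close>

lemma var_ideal_iff_combination:
  fixes c :: "('v::finite, 'k::comm_ring_1) mpoly"
  shows "c \<in> var_ideal (set xs) \<longleftrightarrow> (\<exists>w. c = (\<Sum>b<length xs. w b * var (xs ! b)))"
  using ideal_gen_iff_combination[of c "map var xs"] by (simp add: var_ideal_eq_ideal_gen)

text \<open>An instance of the primality of ideals generated by variables.\<close>

lemma var_ideal_cancel_var:
  fixes c :: "('v::finite, 'k::comm_ring_1) mpoly"
  assumes "c * var x \<in> var_ideal X" "x \<notin> X"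
  shows "c \<in> var_ideal X"
proof -
  have "c \<in> supported {b. (\<lambda>v. b v + unit_exp x v) \<in> {a. \<exists>y\<in>X. 0 < a y}}"
    using assms(1) unfolding var_ideal_def var_eq_monomial mult_monomial_in_supported_iff .
  moreover have "{b. (\<lambda>v. b v + unit_exp x v) \<in> {a. \<exists>y\<in>X. 0 < a y}} = {a. \<exists>y\<in>X. 0 < a y}"
    using assms(2) by (auto simp: unit_exp_def)
  ultimately show ?thesis by (simp add: var_ideal_def)
qed


section \<open>From linear quotients to linear resolutions\<close>

text \<open>Linear quotients for vectors \<open>f 0, \<dots>, f (r - 1)\<close> of a free module of rank \<open>n\<close> that are
  given by their coordinates \<open>f j i\<close>, \<open>i < n\<close>.  The colon ideals are required to be generated
  by variables, not just by linear forms: it is in this form that the property passes to the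
  syzygies.\<close>

definition linear_quotients_in_free_module ::
    "nat \<Rightarrow> nat \<Rightarrow> (nat \<Rightarrow> nat \<Rightarrow> ('v, 'k::comm_ring_1) mpoly) \<Rightarrow> bool" where
  "linear_quotients_in_free_module n r f \<longleftrightarrow>
    (\<forall>j<r. \<exists>X. \<forall>c. (\<exists>u. \<forall>i<n. c * f j i = (\<Sum>l<j. u l * f l i)) \<longleftrightarrow> c \<in> var_ideal X)"

definition syzygy ::
    "nat \<Rightarrow> nat \<Rightarrow> (nat \<Rightarrow> nat \<Rightarrow> 'a::comm_ring_1) \<Rightarrow> (nat \<Rightarrow> 'a) \<Rightarrow> bool" where
  "syzygy n r f u \<longleftrightarrow> (\<forall>i<n. (\<Sum>l<r. u l * f l i) = 0)"

lemma sum_lessThan_add: "(\<Sum>a<m + n. F a) = (\<Sum>a<m. F a) + (\<Sum>b<n. F (m + b))"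
  for F :: "nat \<Rightarrow> 'a::comm_monoid_add"
  by (induction n) (simp_all add: add.assoc)

lemma syzygy_combination:
  assumes "\<And>a. a < q \<Longrightarrow> syzygy n r f (g a)"
  shows "syzygy n r f (\<lambda>l. \<Sum>a<q. w a * g a l)"
  unfolding syzygy_def
proof (intro allI impI)
  fix i assume "i < n"
  have "(\<Sum>l<r. (\<Sum>a<q. w a * g a l) * f l i) = (\<Sum>a<q. w a * (\<Sum>l<r. g a l * f l i))"
    unfolding sum_distrib_left sum_distrib_right mult.assoc by (rule sum.swap)
  also have "\<dots> = 0" using assms \<open>i < n\<close> by (simp add: syzygy_def)
  finally show "(\<Sum>l<r. (\<Sum>a<q. w a * g a l) * f l i) = 0" .
qed

lemma syzygy_diff:
  "syzygy n r f u \<Longrightarrow> syzygy n r f u' \<Longrightarrow> syzygy n r f (\<lambda>l. u l - u' l)"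
  by (simp add: syzygy_def left_diff_distrib sum_subtractf)

lemma syzygy_scale: "syzygy n r f u \<Longrightarrow> syzygy n r f (\<lambda>l. c * u l)"
  unfolding syzygy_def mult.assoc sum_distrib_left[symmetric] by simp

text \<open>Comparing degrees in an equation between a form of degree \<open>d + e\<close> and a combination of forms
  of degree \<open>e\<close>: the parts of the coefficients outside degree \<open>d\<close> contribute nothing in degree
  \<open>d + e\<close>, so they cancel among themselves and can be dropped.\<close>

lemma homogeneous_coefficients:
  fixes p :: "nat \<Rightarrow> ('v::finite, 'k::comm_ring_1) mpoly"
  assumes f: "\<And>l i. l < r \<Longrightarrow> i < n \<Longrightarrow> homogeneous e (f l i)"
    and p: "\<And>i. i < n \<Longrightarrow> homogeneous (d + e) (p i)"
    and eq: "\<And>i. i < n \<Longrightarrow> p i = (\<Sum>l<r. u l * f l i)"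
  obtains c where "\<And>l. homogeneous d (c l)" "\<And>i. i < n \<Longrightarrow> p i = (\<Sum>l<r. c l * f l i)"
proof -
  define D where "D = (\<lambda>d. {a :: 'v \<Rightarrow> nat. sum a UNIV = d})"
  have "\<exists>q s. u l = q + s \<and> q \<in> supported (D d) \<and> s \<in> supported (- D d)" for l
    using supported_split by metis
  then obtain c s where u: "\<And>l. u l = c l + s l"
    and c: "\<And>l. c l \<in> supported (D d)" and s: "\<And>l. s l \<in> supported (- D d)"
    by metis
  have "p i = (\<Sum>l<r. c l * f l i)" if i: "i < n" for i
  proof -
    have "(\<Sum>l<r. s l * f l i) \<in> supported (- D (d + e))"
    proof (rule supported_sum)
      fix l assume "l \<in> {..<r}"
      then have "f l i \<in> supported (D e)"
        using f i by (simp add: D_def homogeneous_iff_supported)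
      with s show "s l * f l i \<in> supported (- D (d + e))"
        by (rule supported_mult) (auto simp: D_def sum.distrib)
    qed
    moreover have "(\<Sum>l<r. s l * f l i) \<in> supported (D (d + e))"
    proof -
      have "(\<Sum>l<r. c l * f l i) \<in> supported (D (d + e))"
      proof (rule supported_sum)
        fix l assume "l \<in> {..<r}"
        then have "f l i \<in> supported (D e)"
          using f i by (simp add: D_def homogeneous_iff_supported)
        with c show "c l * f l i \<in> supported (D (d + e))"
          by (rule supported_mult) (auto simp: D_def sum.distrib)
      qed
      moreover have "p i \<in> supported (D (d + e))"
        using p[OF i] by (simp add: D_def homogeneous_iff_supported)
      moreover have "(\<Sum>l<r. s l * f l i) = p i - (\<Sum>l<r. c l * f l i)"
        by (simp add: eq[OF i] u distrib_right sum.distrib)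
      ultimately show ?thesis by (simp add: supported_diff)
    qed
    ultimately have "(\<Sum>l<r. s l * f l i) = 0"
      using supported_disjoint by blast
    then show ?thesis by (simp add: eq[OF i] u distrib_right sum.distrib)
  qed
  moreover have "homogeneous d (c l)" for l
    using c by (simp add: D_def homogeneous_iff_supported)
  ultimately show ?thesis using that by blast
qed

text \<open>The step that makes a resolution linear.  Let \<open>X\<^sub>j\<close> be the variables generating the colon
  ideal at \<open>f j\<close>.  Each \<open>x \<in> X\<^sub>j\<close> gives a syzygy \<open>x e\<^sub>j - (\<Sum>l<j. c l e\<^sub>l)\<close> whose coefficients can be
  taken to be linear forms.  A syzygy whose last coordinate sits at \<open>j\<close> has this coordinate in the
  ideal of \<open>X\<^sub>j\<close>, so subtracting multiples of these special syzygies pushes it below \<open>j\<close>; thus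
  they generate.  Order them by \<open>j\<close> and then by a fixed order of \<open>X\<^sub>j\<close>.  Looking at coordinate \<open>j\<close>
  one sees that the colon ideal at the syzygy of \<open>x\<close> is generated by the variables of \<open>X\<^sub>j\<close> before
  \<open>x\<close>, so the syzygies have linear quotients again.

  The induction is on the number of vectors.  The part about vanishing beyond \<open>r\<close> lets the
  syzygies of the first \<open>r\<close> vectors count as syzygies of \<open>r + 1\<close> vectors.\<close>

lemma syzygies_have_linear_quotients:
  fixes f :: "nat \<Rightarrow> nat \<Rightarrow> ('v::finite, 'k::comm_ring_1) mpoly"
  assumes "linear_quotients_in_free_module n r f"
    and "\<And>l i. l < r \<Longrightarrow> i < n \<Longrightarrow> homogeneous e (f l i)"
  shows "\<exists>q g. linear_quotients_in_free_module r q g \<and>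
    (\<forall>a l. homogeneous 1 (g a l)) \<and> (\<forall>a<q. \<forall>l\<ge>r. g a l = 0) \<and>
    (\<forall>u. syzygy n r f u \<longleftrightarrow> (\<exists>w. \<forall>l<r. u l = (\<Sum>a<q. w a * g a l)))"
  using assms
proof (induction r)
  case 0
  show ?case
    by (rule exI[of _ 0], rule exI[of _ "\<lambda>_ _. 0"])
      (simp add: linear_quotients_in_free_module_def syzygy_def homogeneous_def)
next
  case (Suc r)
  have "linear_quotients_in_free_module n r f"
    using Suc.prems(1) by (simp add: linear_quotients_in_free_module_def)
  then obtain q g where lq: "linear_quotients_in_free_module r q g"
    and hom: "\<And>a l. homogeneous 1 (g a l)"
    and zero: "\<And>a l. a < q \<Longrightarrow> r \<le> l \<Longrightarrow> g a l = 0"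
    and syz: "\<And>u. syzygy n r f u \<longleftrightarrow> (\<exists>w. \<forall>l<r. u l = (\<Sum>a<q. w a * g a l))"
    using Suc.IH[OF _ Suc.prems(2)[OF less_SucI]] by blast
  obtain X where X: "\<And>c. (\<exists>u. \<forall>i<n. c * f r i = (\<Sum>l<r. u l * f l i)) \<longleftrightarrow> c \<in> var_ideal X"
    using Suc.prems(1) unfolding linear_quotients_in_free_module_def by blast
  obtain xs where xs: "set xs = X" "distinct xs"
    using finite_distinct_list[of X] by auto
  have "\<forall>x\<in>X. \<exists>c. (\<forall>l. homogeneous 1 (c l)) \<and> (\<forall>i<n. var x * f r i = (\<Sum>l<r. c l * f l i))"
  proof
    fix x assume x: "x \<in> X"
    have "var x \<in> var_ideal X"
      using x by (auto simp: var_ideal_def var_eq_monomial unit_exp_def intro!: monomial_in_supported)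
    then obtain u where u: "\<And>i. i < n \<Longrightarrow> var x * f r i = (\<Sum>l<r. u l * f l i)"
      using X by blast
    have "homogeneous (1 + e) (var x * f r i)" if "i < n" for i
    proof -
      have "f r i \<in> supported {a. sum a UNIV = e}"
        using Suc.prems(2)[of r i] that by (simp add: homogeneous_iff_supported)
      moreover have "var x \<in> supported {a. sum a UNIV = 1}"
        by (auto simp: var_eq_monomial unit_exp_def intro!: monomial_in_supported)
      ultimately show ?thesis unfolding homogeneous_iff_supported
        by (rule_tac supported_mult) (auto simp: sum.distrib)
    qed
    then obtain c where "\<And>l. homogeneous 1 (c l)" "\<And>i. i < n \<Longrightarrow> var x * f r i = (\<Sum>l<r. c l * f l i)"
      using homogeneous_coefficients[of r n e f 1 "\<lambda>i. var x * f r i" u] u Suc.prems(2)[OF less_SucI]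
      by blast
    then show "\<exists>c. (\<forall>l. homogeneous 1 (c l)) \<and> (\<forall>i<n. var x * f r i = (\<Sum>l<r. c l * f l i))"
      by blast
  qed
  from bchoice[OF this] obtain c
    where c_all: "\<forall>x\<in>X. (\<forall>l. homogeneous 1 (c x l)) \<and> (\<forall>i<n. var x * f r i = (\<Sum>l<r. c x l * f l i))" ..
  then have c_hom: "homogeneous 1 (c x l)" if "x \<in> X" for x l
    using that by blast
  have c: "var x * f r i = (\<Sum>l<r. c x l * f l i)" if "x \<in> X" "i < n" for x i
    using c_all that by blast
  define s where "s x l = (if l < r then - c x l else if l = r then var x else 0)" for x l
  define h where "h a = (if a < q then g a else if a < q + length xs then s (xs ! (a - q)) else (\<lambda>_. 0))" for a
  have xs_X: "xs ! b \<in> X" if "b < length xs" for b using xs(1) that by auto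
  have h_old: "h a = g a" if "a < q" for a using that by (simp add: h_def)
  have h_new: "h (q + b) = s (xs ! b)" if "b < length xs" for b using that by (simp add: h_def)
  have s_r: "s x r = var x" for x by (simp add: s_def)
  have g_syz: "syzygy n (Suc r) f (g a)" if "a < q" for a
  proof -
    have "\<exists>w. \<forall>l<r. g a l = (\<Sum>a'<q. w a' * g a' l)"
    proof (intro exI allI impI)
      fix l
      show "g a l = (\<Sum>a'<q. (if a' = a then 1 else 0) * g a' l)"
        using that by (simp add: if_distrib[of "\<lambda>x. x * _"] cong: if_cong)
    qed
    then have "syzygy n r f (g a)" using syz by blast
    then show ?thesis using zero[OF that, of r] by (simp add: syzygy_def)
  qed
  have s_syz: "syzygy n (Suc r) f (s x)" if "x \<in> X" for x
    using c[OF that] by (simp add: syzygy_def s_def sum_negf)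
  have h_syz: "syzygy n (Suc r) f (h a)" if "a < q + length xs" for a
  proof (cases "a < q")
    case True
    then show ?thesis using g_syz h_old by simp
  next
    case False
    then show ?thesis using s_syz xs_X that by (simp add: h_def)
  qed
  \<comment> \<open>syzygies that do not involve the new vector\<close>
  have reduce: "\<exists>w. \<forall>l<Suc r. z l = (\<Sum>a<q. w a * g a l)"
    if "syzygy n (Suc r) f z" "z r = 0" for z
  proof -
    have "syzygy n r f z" using that by (simp add: syzygy_def)
    then obtain w where "\<forall>l<r. z l = (\<Sum>a<q. w a * g a l)" using syz by blast
    then have "\<forall>l<Suc r. z l = (\<Sum>a<q. w a * g a l)"
      using that(2) zero[of _ r] by (auto simp: less_Suc_eq)
    then show ?thesis by blast
  qed
  have split: "(\<Sum>a<q + b. w a * h a l) = (\<Sum>a<q. w a * g a l) + (\<Sum>b'<b. w (q + b') * s (xs ! b') l)"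
    if "b \<le> length xs" for w b l
    using that by (simp add: sum_lessThan_add h_old h_new)
  \<comment> \<open>Subtract from \<open>z\<close> the combination of new syzygies that has the same coordinate \<open>r\<close>.\<close>
  have join: "\<exists>w. \<forall>l<Suc r. z l = (\<Sum>a<q + b. w a * h a l)"
    if z: "syzygy n (Suc r) f z" and b: "b \<le> length xs"
      and zr: "z r \<in> var_ideal (set (take b xs))" for z b
  proof -
    obtain v where v: "z r = (\<Sum>b'<b. v b' * var (xs ! b'))"
      using zr b unfolding var_ideal_iff_combination by auto
    let ?y = "\<lambda>l. \<Sum>b'<b. v b' * s (xs ! b') l"
    have "syzygy n (Suc r) f ?y"
      using b by (intro syzygy_combination s_syz xs_X) simp
    then have "syzygy n (Suc r) f (\<lambda>l. z l - ?y l)" using z by (rule syzygy_diff[rotated])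
    moreover have "z r - ?y r = 0" by (simp add: v s_r)
    ultimately obtain w where w: "\<And>l. l < Suc r \<Longrightarrow> z l - ?y l = (\<Sum>a<q. w a * g a l)"
      using reduce[of "\<lambda>l. z l - ?y l"] by blast
    show ?thesis
    proof (intro exI allI impI)
      fix l assume "l < Suc r"
      from w[OF this] show "z l = (\<Sum>a<q + b. (if a < q then w a else v (a - q)) * h a l)"
        by (simp add: split[OF b] diff_eq_eq)
    qed
  qed
  have "linear_quotients_in_free_module (Suc r) (q + length xs) h"
    unfolding linear_quotients_in_free_module_def
  proof (intro allI impI)
    fix a assume a: "a < q + length xs"
    show "\<exists>Y. \<forall>c. (\<exists>u. \<forall>i<Suc r. c * h a i = (\<Sum>l<a. u l * h l i)) \<longleftrightarrow> c \<in> var_ideal Y"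
    proof (cases "a < q")
      case True
      obtain Y where Y: "\<And>c. (\<exists>u. \<forall>i<r. c * g a i = (\<Sum>l<a. u l * g l i)) \<longleftrightarrow> c \<in> var_ideal Y"
        using lq True unfolding linear_quotients_in_free_module_def by blast
      have last: "c * h a r = (\<Sum>l<a. u l * h l r)" for c u
        using True zero[of _ r] by (simp add: h_old)
      have eq: "(\<forall>i<Suc r. c * h a i = (\<Sum>l<a. u l * h l i)) \<longleftrightarrow>
          (\<forall>i<r. c * g a i = (\<Sum>l<a. u l * g l i))" for c u
        unfolding All_less_Suc using True last by (simp add: h_old)
      show ?thesis by (intro exI[of _ Y] allI) (simp only: eq Y)
    next
      case False
      then obtain b where b: "a = q + b" "b < length xs"
        using a by (metis add_less_cancel_left le_add_diff_inverse not_less)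
      let ?x = "xs ! b"
      have x_notin: "?x \<notin> set (take b xs)"
        using xs(2) b(2) by (auto simp: in_set_conv_nth nth_eq_iff_index_eq)
      have "(\<exists>u. \<forall>i<Suc r. c * h a i = (\<Sum>l<a. u l * h l i)) \<longleftrightarrow> c \<in> var_ideal (set (take b xs))" for c
      proof
        assume "\<exists>u. \<forall>i<Suc r. c * h a i = (\<Sum>l<a. u l * h l i)"
        then obtain u where "c * h a r = (\<Sum>l<a. u l * h l r)" by blast
        then have "c * var ?x = (\<Sum>b'<b. u (q + b') * var (xs ! b'))"
          using b zero[of _ r] by (simp add: split h_new s_r)
        then have "c * var ?x \<in> var_ideal (set (take b xs))"
          unfolding var_ideal_iff_combination using b(2) by auto
        then show "c \<in> var_ideal (set (take b xs))"
          using x_notin by (rule var_ideal_cancel_var)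
      next
        assume "c \<in> var_ideal (set (take b xs))"
        then have "c * h a r \<in> var_ideal (set (take b xs))"
          unfolding var_ideal_eq_ideal_gen ideal_gen_def mult.commute[of c]
          by (rule ring_module.span_scale)
        moreover have "syzygy n (Suc r) f (\<lambda>l. c * h a l)"
          using h_syz[OF a] by (rule syzygy_scale)
        ultimately show "\<exists>u. \<forall>i<Suc r. c * h a i = (\<Sum>l<a. u l * h l i)"
          using join[of "\<lambda>l. c * h a l" b] b by simp
      qed
      then show ?thesis by blast
    qed
  qed
  moreover have "\<forall>a l. homogeneous 1 (h a l)"
  proof (intro allI)
    fix a l
    have s_hom: "homogeneous 1 (s x l)" if "x \<in> X" for x
      using c_hom[OF that, of l] unfolding s_def homogeneous_iff_supported
      by (auto simp: var_eq_monomial unit_exp_def intro!: monomial_in_supported supported_uminus)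
    then show "homogeneous 1 (h a l)"
      using hom[of a l] s_hom[OF xs_X, of "a - q"] by (simp add: h_def homogeneous_def)
  qed
  moreover have "\<forall>a<q + length xs. \<forall>l\<ge>Suc r. h a l = 0"
    using zero by (auto simp: h_def s_def)
  moreover have "syzygy n (Suc r) f u \<longleftrightarrow> (\<exists>w. \<forall>l<Suc r. u l = (\<Sum>a<q + length xs. w a * h a l))" for u
  proof
    assume u: "syzygy n (Suc r) f u"
    have "u r * f r i = (\<Sum>l<r. - u l * f l i)" if "i < n" for i
      using u that by (simp add: syzygy_def sum_negf eq_neg_iff_add_eq_0 add.commute)
    then have "\<exists>u'. \<forall>i<n. u r * f r i = (\<Sum>l<r. u' l * f l i)"
      by (intro exI[of _ "\<lambda>l. - u l"]) simp
    then have "u r \<in> var_ideal X" using X by blast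
    then show "\<exists>w. \<forall>l<Suc r. u l = (\<Sum>a<q + length xs. w a * h a l)"
      using join[OF u, of "length xs"] xs(1) by simp
  next
    assume "\<exists>w. \<forall>l<Suc r. u l = (\<Sum>a<q + length xs. w a * h a l)"
    then obtain w where "\<And>l. l < Suc r \<Longrightarrow> u l = (\<Sum>a<q + length xs. w a * h a l)" by blast
    moreover have "syzygy n (Suc r) f (\<lambda>l. \<Sum>a<q + length xs. w a * h a l)"
      using h_syz by (rule syzygy_combination)
    ultimately show "syzygy n (Suc r) f u" by (simp add: syzygy_def)
  qed
  ultimately show ?case by blast
qed


text \<open>Iterating the passage to syzygies yields all the maps of the resolution at once, by dependent
  choice.  A state \<open>(n, q, g)\<close> consists of \<open>q\<close> vectors \<open>g\<close> in a free module of rank \<open>n\<close>, which are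
  the columns of the next matrix.\<close>

lemma linear_quotients_imp_linear_resolution:
  fixes f :: "nat \<Rightarrow> nat \<Rightarrow> ('v::finite, 'k::comm_ring_1) mpoly"
  assumes lq: "linear_quotients_in_free_module 1 r f"
    and hom: "\<And>l. l < r \<Longrightarrow> homogeneous d (f l 0)"
  shows "has_linear_resolution {\<Sum>l<r. u l * f l 0 | u. True}"
proof -
  define P where "P k s = (case s of (n, q, g) \<Rightarrow>
    linear_quotients_in_free_module n q g \<and>
    (\<forall>l<q. \<forall>i<n. homogeneous (if k = 0 then d else 1) (g l i)) \<and> (k = 0 \<longrightarrow> s = (1, r, f)))"
    for k :: nat and s :: "nat \<times> nat \<times> (nat \<Rightarrow> nat \<Rightarrow> ('v, 'k) mpoly)"
  define Q where "Q s s' = (case s of (n, q, g) \<Rightarrow> case s' of (n', q', g') \<Rightarrow> n' = q \<and>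
      (\<forall>u. syzygy n q g u \<longleftrightarrow> (\<exists>w. \<forall>l<q. u l = (\<Sum>a<q'. w a * g' a l))))"
    for s s' :: "nat \<times> nat \<times> (nat \<Rightarrow> nat \<Rightarrow> ('v, 'k) mpoly)"
  have "\<exists>S. \<forall>k. P k (S k) \<and> Q (S k) (S (Suc k))"
  proof (rule dependent_nat_choice)
    show "\<exists>s. P 0 s"
      by (rule exI[of _ "(1, r, f)"]) (use lq in \<open>simp add: P_def hom\<close>)
  next
    fix s and k :: nat
    assume "P k s"
    then obtain n q g where s: "s = (n, q, g)"
      and "linear_quotients_in_free_module n q g"
      and "\<And>l i. l < q \<Longrightarrow> i < n \<Longrightarrow> homogeneous (if k = 0 then d else 1) (g l i)"
      by (cases s) (simp add: P_def)
    then obtain q' g' where "linear_quotients_in_free_module q q' g'"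
      "\<forall>a l. homogeneous 1 (g' a l)"
      "\<forall>u. syzygy n q g u \<longleftrightarrow> (\<exists>w. \<forall>l<q. u l = (\<Sum>a<q'. w a * g' a l))"
      using syzygies_have_linear_quotients by blast
    then have "P (Suc k) (q, q', g') \<and> Q s (q, q', g')"
      by (simp add: P_def Q_def s)
    then show "\<exists>s'. P (Suc k) s' \<and> Q s s'" ..
  qed
  then obtain S where S: "\<And>k. P k (S k)" "\<And>k. Q (S k) (S (Suc k))" by blast
  define N where "N k = fst (S k)" for k
  define b where "b k = fst (snd (S k))" for k
  define F where "F k = snd (snd (S k))" for k
  have S_eq: "S k = (N k, b k, F k)" for k by (simp add: N_def b_def F_def)
  have start: "N 0 = 1" "b 0 = r" "F 0 = f" using S(1)[of 0] by (simp_all add: P_def S_eq)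
  have N_Suc: "N (Suc k) = b k" for k using S(2)[of k] by (simp add: Q_def S_eq)
  have F_hom: "homogeneous (if k = 0 then d else 1) (F k l i)" if "l < b k" "i < N k" for k l i
    using S(1)[of k] that by (simp add: P_def S_eq)
  have F_syz: "syzygy (N k) (b k) (F k) u \<longleftrightarrow>
      (\<exists>w. \<forall>l<b k. u l = (\<Sum>a<b (Suc k). w a * F (Suc k) a l))" for k u
    using S(2)[of k] by (simp add: Q_def S_eq)
  define A where "A k = mat (N k) (b k) (\<lambda>(i, j). F k j i)" for k
  have A_carrier: "A k \<in> carrier_mat (N k) (b k)" for k by (simp add: A_def)
  have A_mult: "(A k *\<^sub>v u) $ i = (\<Sum>l<b k. u $ l * F k l i)"
    if "u \<in> carrier_vec (b k)" "i < N k" for k u i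
    using that by (simp add: A_def scalar_prod_def lessThan_atLeast0 mult.commute)
  have A_entries: "homogeneous (if k = 0 then d else 1) p" if "p \<in> elements_mat (A k)" for k p
    using that F_hom[of _ k] by (auto simp: elements_mat_def A_def)
  have kernel: "mat_kernel (A k) = (\<lambda>u. A (Suc k) *\<^sub>v u) ` carrier_vec (b (Suc k))" for k
  proof -
    have "A k *\<^sub>v v = 0\<^sub>v (N k) \<longleftrightarrow> v \<in> (\<lambda>u. A (Suc k) *\<^sub>v u) ` carrier_vec (b (Suc k))"
      if v: "v \<in> carrier_vec (b k)" for v
    proof -
      have "A k *\<^sub>v v = 0\<^sub>v (N k) \<longleftrightarrow> (\<forall>i<N k. (A k *\<^sub>v v) $ i = 0)"
        using A_carrier[of k] by (auto simp: vec_eq_iff)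
      also have "\<dots> \<longleftrightarrow> syzygy (N k) (b k) (F k) (\<lambda>l. v $ l)"
        using A_mult[OF v] by (simp add: syzygy_def)
      also have "\<dots> \<longleftrightarrow> (\<exists>w. \<forall>l<b k. v $ l = (\<Sum>a<b (Suc k). w a * F (Suc k) a l))"
        by (rule F_syz)
      also have "\<dots> \<longleftrightarrow> v \<in> (\<lambda>u. A (Suc k) *\<^sub>v u) ` carrier_vec (b (Suc k))"
      proof
        assume "\<exists>w. \<forall>l<b k. v $ l = (\<Sum>a<b (Suc k). w a * F (Suc k) a l)"
        then obtain w where w: "\<And>l. l < b k \<Longrightarrow> v $ l = (\<Sum>a<b (Suc k). w a * F (Suc k) a l)"
          by blast
        have "v = A (Suc k) *\<^sub>v vec (b (Suc k)) w"
        proof (rule eq_vecI)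
          fix i assume "i < dim_vec (A (Suc k) *\<^sub>v vec (b (Suc k)) w)"
          then have "i < b k" using A_carrier[of "Suc k"] by (simp add: N_Suc)
          then show "v $ i = (A (Suc k) *\<^sub>v vec (b (Suc k)) w) $ i"
            using w by (simp add: A_mult N_Suc)
        qed (use v A_carrier[of "Suc k"] in \<open>simp add: N_Suc\<close>)
        then show "v \<in> (\<lambda>u. A (Suc k) *\<^sub>v u) ` carrier_vec (b (Suc k))" by auto
      next
        assume "v \<in> (\<lambda>u. A (Suc k) *\<^sub>v u) ` carrier_vec (b (Suc k))"
        then obtain u where u: "v = A (Suc k) *\<^sub>v u" "u \<in> carrier_vec (b (Suc k))" by blast
        then have "\<forall>l<b k. v $ l = (\<Sum>a<b (Suc k). u $ a * F (Suc k) a l)"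
          by (simp add: A_mult N_Suc)
        then show "\<exists>w. \<forall>l<b k. v $ l = (\<Sum>a<b (Suc k). w a * F (Suc k) a l)" by blast
      qed
      finally show ?thesis .
    qed
    moreover have "A (Suc k) *\<^sub>v u \<in> carrier_vec (b k)" for u
      by (rule carrier_vecI) (simp add: carrier_matD(1)[OF A_carrier] N_Suc)
    ultimately show ?thesis
      unfolding mat_kernel[OF A_carrier] by blast
  qed
  have image: "{(A 0 *\<^sub>v u) $ 0 | u. u \<in> carrier_vec (b 0)} = {\<Sum>l<r. u l * f l 0 | u. True}"
  proof (intro equalityI subsetI)
    fix p assume "p \<in> {(A 0 *\<^sub>v u) $ 0 | u. u \<in> carrier_vec (b 0)}"
    then obtain u where "p = (A 0 *\<^sub>v u) $ 0" "u \<in> carrier_vec (b 0)" by blast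
    then have "p = (\<Sum>l<r. u $ l * f l 0)" by (simp add: A_mult start)
    then show "p \<in> {\<Sum>l<r. u l * f l 0 | u. True}"
      by (intro CollectI exI[of _ "\<lambda>l. u $ l"] conjI) simp_all
  next
    fix p assume "p \<in> {\<Sum>l<r. u l * f l 0 | u. True}"
    then obtain u where "p = (\<Sum>l<r. u l * f l 0)" by blast
    then have "p = (A 0 *\<^sub>v vec (b 0) u) $ 0" by (simp add: A_mult start)
    then show "p \<in> {(A 0 *\<^sub>v u) $ 0 | u. u \<in> carrier_vec (b 0)}"
      by (intro CollectI exI[of _ "vec (b 0) u"] conjI) simp_all
  qed
  show ?thesis
    unfolding has_linear_resolution_def
  proof (intro exI[of _ d] exI[of _ b] exI[of _ A] conjI allI)
    show "A 0 \<in> carrier_mat 1 (b 0)" using A_carrier[of 0] by (simp add: start)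
    show "\<forall>p\<in>elements_mat (A 0). homogeneous d p" using A_entries[of _ 0] by simp
    show "{(A 0 *\<^sub>v u) $ 0 | u. u \<in> carrier_vec (b 0)} = {\<Sum>l<r. u l * f l 0 | u. True}"
      by (rule image)
    fix k
    show "A (Suc k) \<in> carrier_mat (b k) (b (Suc k))" using A_carrier[of "Suc k"] by (simp add: N_Suc)
    show "\<forall>p\<in>elements_mat (A (Suc k)). homogeneous 1 p" using A_entries[of _ "Suc k"] by simp
    show "mat_kernel (A k) = (\<lambda>u. A (Suc k) *\<^sub>v u) ` carrier_vec (b (Suc k))" by (rule kernel)
  qed
qed

section \<open>Monomial ideals with linear quotients\<close>

text \<open>Linear quotients of a list of monomials, in terms of exponents: for \<open>i < j\<close> the quotient of
  \<open>as ! i\<close> by its greatest common divisor with \<open>as ! j\<close> is divisible by a variable \<open>s\<close> of the colon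
  ideal at \<open>as ! j\<close>.\<close>

definition variable_quotients :: "('v \<Rightarrow> nat) list \<Rightarrow> bool" where
  "variable_quotients as \<longleftrightarrow> (\<forall>j<length as. \<forall>i<j. \<exists>s. (as ! j) s < (as ! i) s \<and>
    (\<exists>l<j. as ! l \<le> (\<lambda>v. (as ! j) v + unit_exp s v)))"

lemma variable_quotients_colon:
  fixes c :: "('v::finite, 'k::comm_ring_1) mpoly"
  assumes "variable_quotients as" "j < length as"
  shows "c * monomial (as ! j) \<in> supported (up_closure (set (take j as))) \<longleftrightarrow>
    c \<in> var_ideal {s. \<exists>l<j. as ! l \<le> (\<lambda>v. (as ! j) v + unit_exp s v)}"
proof -
  have "(\<lambda>v. b v + (as ! j) v) \<in> up_closure (set (take j as)) \<longleftrightarrow>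
      (\<exists>s\<in>{s. \<exists>l<j. as ! l \<le> (\<lambda>v. (as ! j) v + unit_exp s v)}. 0 < b s)" for b
  proof
    assume "(\<lambda>v. b v + (as ! j) v) \<in> up_closure (set (take j as))"
    then obtain i where i: "i < j" "as ! i \<le> (\<lambda>v. b v + (as ! j) v)"
      using assms(2) by (auto simp: up_closure_def in_set_conv_nth)
    obtain s where s: "(as ! j) s < (as ! i) s" "\<exists>l<j. as ! l \<le> (\<lambda>v. (as ! j) v + unit_exp s v)"
      using assms i(1) unfolding variable_quotients_def by blast
    have "0 < b s" using s(1) le_funD[OF i(2), of s] by simp
    with s(2) show "\<exists>s\<in>{s. \<exists>l<j. as ! l \<le> (\<lambda>v. (as ! j) v + unit_exp s v)}. 0 < b s"
      by blast
  next
    assume "\<exists>s\<in>{s. \<exists>l<j. as ! l \<le> (\<lambda>v. (as ! j) v + unit_exp s v)}. 0 < b s"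
    then obtain s l where s: "0 < b s" and l: "l < j" "as ! l \<le> (\<lambda>v. (as ! j) v + unit_exp s v)"
      by blast
    note l(2)
    also have "(\<lambda>v. (as ! j) v + unit_exp s v) \<le> (\<lambda>v. b v + (as ! j) v)"
      using s by (simp add: le_fun_def unit_exp_def)
    finally have "as ! l \<le> (\<lambda>v. b v + (as ! j) v)" .
    moreover have "as ! l \<in> set (take j as)"
      using l(1) assms(2) by (auto simp: in_set_conv_nth)
    ultimately show "(\<lambda>v. b v + (as ! j) v) \<in> up_closure (set (take j as))"
      unfolding up_closure_def by blast
  qed
  then show ?thesis by (simp add: mult_monomial_in_supported_iff var_ideal_def)
qed

lemma variable_quotients_imp_has_linear_quotients:
  assumes "variable_quotients (as :: ('v::finite \<Rightarrow> nat) list)"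
  shows "has_linear_quotients (supported (up_closure (set as)) :: ('v, 'k::comm_ring_1) mpoly set)"
proof -
  let ?gs = "map monomial as :: ('v, 'k) mpoly list"
  have "homogeneous (sum a UNIV) (monomial a :: ('v, 'k) mpoly)" for a
    by (simp add: homogeneous_iff_supported monomial_in_supported)
  then have "\<forall>g\<in>set ?gs. \<exists>d. homogeneous d g" by auto
  moreover have "supported (up_closure (set as)) = ideal_gen (set ?gs)"
    by (simp add: ideal_gen_monomials)
  moreover have "generated_by_linear_forms (colon (ideal_gen (set (take j ?gs))) (?gs ! j))"
    if j: "j < length ?gs" for j
  proof -
    have "ideal_gen (set (take j ?gs)) = supported (up_closure (set (take j as)))"
      by (simp add: take_map ideal_gen_monomials)
    then have "colon (ideal_gen (set (take j ?gs))) (?gs ! j) =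
        var_ideal {s. \<exists>l<j. as ! l \<le> (\<lambda>v. (as ! j) v + unit_exp s v)}"
      using j variable_quotients_colon[OF assms, of j] by (auto simp: colon_def)
    then show ?thesis by (simp add: var_ideal_generated_by_linear_forms)
  qed
  ultimately show ?thesis
    unfolding has_linear_quotients_def Let_def by blast
qed

lemma variable_quotients_imp_linear_resolution:
  assumes "variable_quotients (as :: ('v::finite \<Rightarrow> nat) list)"
    and "\<And>a. a \<in> set as \<Longrightarrow> sum a UNIV = d"
  shows "has_linear_resolution (supported (up_closure (set as)) :: ('v, 'k::comm_ring_1) mpoly set)"
proof -
  define f :: "nat \<Rightarrow> nat \<Rightarrow> ('v, 'k) mpoly" where "f l i = monomial (as ! l)" for l i
  have prefix: "p \<in> supported (up_closure (set (take j as))) \<longleftrightarrow> (\<exists>u. p = (\<Sum>l<j. u l * f l 0))"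
    if "j \<le> length as" for j p
    using ideal_gen_iff_combination[of p "map monomial (take j as)"] that
    by (simp add: ideal_gen_monomials f_def)
  have "linear_quotients_in_free_module 1 (length as) f"
    unfolding linear_quotients_in_free_module_def
  proof (intro allI impI)
    fix j assume j: "j < length as"
    have "(\<exists>u. \<forall>i<1. c * f j i = (\<Sum>l<j. u l * f l i)) \<longleftrightarrow>
        c * monomial (as ! j) \<in> supported (up_closure (set (take j as)))" for c
      using j by (simp add: prefix f_def)
    then show "\<exists>X. \<forall>c. (\<exists>u. \<forall>i<1. c * f j i = (\<Sum>l<j. u l * f l i)) \<longleftrightarrow> c \<in> var_ideal X"
      using variable_quotients_colon[OF assms(1) j] by auto
  qed
  moreover have "homogeneous d (f l 0)" if "l < length as" for l
    using assms(2)[of "as ! l"] that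
    by (simp add: f_def homogeneous_iff_supported monomial_in_supported)
  ultimately have "has_linear_resolution {\<Sum>l<length as. u l * f l 0 | u. True}"
    by (rule linear_quotients_imp_linear_resolution)
  moreover have "{\<Sum>l<length as. u l * f l 0 | u. True} = supported (up_closure (set as))"
    using prefix[of "length as"] by auto
  ultimately show ?thesis by simp
qed


section \<open>An exchange property\<close>

definition lex_less :: "('v \<Rightarrow> nat) \<Rightarrow> ('v \<Rightarrow> nat) \<Rightarrow> ('v \<Rightarrow> nat) \<Rightarrow> bool" where
  "lex_less rank u v \<longleftrightarrow> (\<exists>t. u t < v t \<and> (\<forall>s. rank s < rank t \<longrightarrow> u s = v s))"

text \<open>Exponents are compared along the order of the variables given by \<open>rank\<close>, and smaller ones
  come first.  Unlike the exchange properties of polymatroidal type, the unit taken away need not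
  sit at the first place where \<open>u\<close> and \<open>v\<close> differ, but anywhere before the place of the added
  unit, and \<open>u\<close>, \<open>v\<close> may have different degrees.  The hypothesis \<open>\<not> u \<le> v\<close> holds automatically
  for distinct minimal exponents and for distinct exponents of the same degree.\<close>

definition exchange_property :: "('v \<Rightarrow> nat) \<Rightarrow> ('v \<Rightarrow> nat) set \<Rightarrow> bool" where
  "exchange_property rank U \<longleftrightarrow>
    (\<forall>u\<in>U. \<forall>v\<in>U. lex_less rank u v \<and> \<not> u \<le> v \<longrightarrow>
      (\<exists>r s. rank r < rank s \<and> v s < u s \<and> 0 < v r \<and> v(r := v r - 1, s := v s + 1) \<in> U))"

lemma lex_less_irrefl: "\<not> lex_less rank u u"
  by (simp add: lex_less_def)

lemma first_difference:
  fixes rank :: "'v \<Rightarrow> nat"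
  assumes "u \<noteq> v"
  obtains t where "u t \<noteq> v t" "\<And>s. rank s < rank t \<Longrightarrow> u s = v s"
proof -
  obtain t0 where "u t0 \<noteq> v t0" using assms by blast
  then show ?thesis
    using ex_has_least_nat[of "\<lambda>t. u t \<noteq> v t" t0 rank] that by (meson not_less)
qed

lemma lex_less_trans:
  assumes "inj rank" "lex_less rank u v" "lex_less rank v w"
  shows "lex_less rank u w"
proof -
  obtain t where t: "u t < v t" "\<And>s. rank s < rank t \<Longrightarrow> u s = v s"
    using assms(2) by (auto simp: lex_less_def)
  obtain t' where t': "v t' < w t'" "\<And>s. rank s < rank t' \<Longrightarrow> v s = w s"
    using assms(3) by (auto simp: lex_less_def)
  consider "rank t < rank t'" | "rank t' < rank t" | "t = t'"
    using injD[OF assms(1)] by (metis nat_neq_iff)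
  then show ?thesis
  proof cases
    case 1
    then have "u t < w t \<and> (\<forall>s. rank s < rank t \<longrightarrow> u s = w s)" using t t' by simp
    then show ?thesis unfolding lex_less_def by (rule exI)
  next
    case 2
    then have "u t' < w t' \<and> (\<forall>s. rank s < rank t' \<longrightarrow> u s = w s)" using t t' by simp
    then show ?thesis unfolding lex_less_def by (rule exI)
  next
    case 3
    then have "u t < w t \<and> (\<forall>s. rank s < rank t \<longrightarrow> u s = w s)" using t t' by simp
    then show ?thesis unfolding lex_less_def by (rule exI)
  qed
qed

lemma lex_less_linear:
  fixes rank :: "'v \<Rightarrow> nat"
  assumes "u \<noteq> v"
  shows "lex_less rank u v \<or> lex_less rank v u"
proof -
  obtain t where "u t \<noteq> v t" "\<And>s. rank s < rank t \<Longrightarrow> u s = v s"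
    using first_difference[OF assms] by blast
  then show ?thesis unfolding lex_less_def by (metis nat_neq_iff)
qed

lemma le_imp_lex_le:
  fixes rank :: "'v \<Rightarrow> nat"
  assumes "w \<le> v" "w \<noteq> v"
  shows "lex_less rank w v"
proof -
  obtain t where t: "w t \<noteq> v t" "\<And>s. rank s < rank t \<Longrightarrow> w s = v s"
    using first_difference[OF assms(2)] by blast
  then have "w t < v t" using le_funD[OF assms(1), of t] by simp
  with t(2) show ?thesis unfolding lex_less_def by blast
qed

lemma lex_less_exchange:
  fixes v :: "'v \<Rightarrow> nat"
  assumes "rank r < rank s" "0 < v r"
  shows "lex_less rank (v(r := v r - 1, s := v s + 1)) v"
  unfolding lex_less_def
proof (intro exI[of _ r] conjI allI impI)
  have "r \<noteq> s" using assms(1) by blast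
  then show "(v(r := v r - 1, s := v s + 1)) r < v r" using assms(2) by simp
  fix x assume "rank x < rank r"
  then have "x \<noteq> r" "x \<noteq> s" using assms(1) by auto
  then show "(v(r := v r - 1, s := v s + 1)) x = v x" by simp
qed

text \<open>The list is sorted by the number of smaller elements, a key with values in a linear order.\<close>

lemma lex_sorted_list:
  fixes F :: "('v \<Rightarrow> nat) set"
  assumes "finite F" "inj rank"
  obtains as where "set as = F"
    and "\<And>i j. i < length as \<Longrightarrow> j < length as \<Longrightarrow> lex_less rank (as ! i) (as ! j) \<longleftrightarrow> i < j"
proof -
  define key where "key u = card {w \<in> F. lex_less rank w u}" for u
  have key: "key u < key v" if "u \<in> F" "lex_less rank u v" for u v
    unfolding key_def
  proof (rule psubset_card_mono)
    show "{w \<in> F. lex_less rank w u} \<subset> {w \<in> F. lex_less rank w v}"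
      using that lex_less_trans[OF assms(2)] lex_less_irrefl by blast
  qed (use assms(1) in simp)
  obtain ys where ys: "set ys = F" "distinct ys"
    using finite_distinct_list[OF assms(1)] by blast
  define as where "as = sort_key key ys"
  have as: "set as = F" "distinct as" "sorted (map key as)"
    using ys by (simp_all add: as_def)
  have fwd: "lex_less rank (as ! i) (as ! j)" if "i < j" "j < length as" for i j
  proof -
    have "key (as ! i) \<le> key (as ! j)"
      using sorted_nth_mono[OF as(3), of i j] that by simp
    then have "\<not> lex_less rank (as ! j) (as ! i)"
      using key[of "as ! j" "as ! i"] as(1) that(2) nth_mem by fastforce
    moreover have "as ! i \<noteq> as ! j"
      using as(2) that by (simp add: nth_eq_iff_index_eq)
    ultimately show ?thesis using lex_less_linear by blast
  qed
  have "lex_less rank (as ! i) (as ! j) \<longleftrightarrow> i < j" if "i < length as" "j < length as" for i j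
    using fwd[of i j] fwd[of j i] that lex_less_irrefl lex_less_trans[OF assms(2)]
    by (metis nat_neq_iff)
  with as(1) show ?thesis by (rule that)
qed

text \<open>List \<open>F\<close> in lexicographic order.  For \<open>u\<close> before \<open>v\<close> the exchange moves a unit of \<open>v\<close> from
  \<open>r\<close> to a later variable \<open>s\<close>, and so produces a smaller exponent in \<open>U\<close>.  An element of
  \<open>F\<close> below it comes no later, since the lexicographic order refines divisibility, and it
  divides \<open>v\<close> times the variable \<open>s\<close>, which is what is needed.\<close>

lemma exchange_imp_variable_quotients:
  fixes F :: "('v \<Rightarrow> nat) set"
  assumes rank: "inj rank" and exchange: "exchange_property rank U"
    and F: "finite F" "F \<subseteq> U"
    and antichain: "\<And>u v. u \<in> F \<Longrightarrow> v \<in> F \<Longrightarrow> u \<le> v \<Longrightarrow> u = v"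
    and below: "\<And>v r s. v \<in> F \<Longrightarrow> r \<noteq> s \<Longrightarrow> 0 < v r \<Longrightarrow> v(r := v r - 1, s := v s + 1) \<in> U \<Longrightarrow>
      \<exists>w\<in>F. w \<le> v(r := v r - 1, s := v s + 1)"
  obtains as where "set as = F" "variable_quotients as"
proof -
  obtain as where as: "set as = F"
    and lex: "\<And>i j. i < length as \<Longrightarrow> j < length as \<Longrightarrow> lex_less rank (as ! i) (as ! j) \<longleftrightarrow> i < j"
    using lex_sorted_list[OF F(1) rank] by blast
  have "variable_quotients as"
    unfolding variable_quotients_def
  proof (intro allI impI)
    fix i j assume j: "j < length as" and i: "i < j"
    define u where "u = as ! i"
    define v where "v = as ! j"
    have uv: "u \<in> F" "v \<in> F" "lex_less rank u v"
      using i j as lex[of i j] by (auto simp: u_def v_def)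
    then have "\<not> u \<le> v"
      using antichain[of u v] lex_less_irrefl[of rank v] by blast
    then obtain r s where rs: "rank r < rank s" "v s < u s" "0 < v r"
      and w: "v(r := v r - 1, s := v s + 1) \<in> U"
      using exchange uv F(2) unfolding exchange_property_def by blast
    let ?w = "v(r := v r - 1, s := v s + 1)"
    have "r \<noteq> s" using rs(1) by blast
    then obtain w' where w': "w' \<in> F" "w' \<le> ?w"
      using below[OF uv(2) _ rs(3) w] by blast
    have "lex_less rank ?w v" using rs(1,3) by (rule lex_less_exchange)
    moreover have "w' = ?w \<or> lex_less rank w' ?w"
      using le_imp_lex_le[OF w'(2), of rank] by blast
    ultimately have "lex_less rank w' v"
      using lex_less_trans[OF rank] by blast
    moreover obtain l where l: "l < length as" "as ! l = w'"
      using w'(1) as by (metis in_set_conv_nth)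
    ultimately have "l < j" using lex[OF l(1) j] by (simp add: v_def)
    moreover have "w' \<le> (\<lambda>x. v x + unit_exp s x)"
    proof (rule order_trans[OF w'(2)])
      show "?w \<le> (\<lambda>x. v x + unit_exp s x)" by (simp add: le_fun_def unit_exp_def)
    qed
    ultimately show "\<exists>s. (as ! j) s < (as ! i) s \<and> (\<exists>l<j. as ! l \<le> (\<lambda>x. (as ! j) x + unit_exp s x))"
      using rs(2) l(2) unfolding u_def v_def by blast
  qed
  with as show ?thesis by (rule that)
qed

lemma sum_strict_mono_exponent:
  fixes u v :: "'v::finite \<Rightarrow> nat"
  assumes "u \<le> v" "u \<noteq> v"
  shows "sum u UNIV < sum v UNIV"
proof (rule sum_strict_mono_ex1)
  show "\<forall>x\<in>UNIV. u x \<le> v x" using le_funD[OF assms(1)] by blast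
  show "\<exists>x\<in>UNIV. u x < v x"
    using assms le_funD[OF assms(1)] by (metis UNIV_I ext le_neq_implies_less)
qed simp

lemma minimal_exponent_below:
  fixes U :: "('v::finite \<Rightarrow> nat) set"
  assumes "u \<in> U"
  shows "\<exists>w\<in>U. w \<le> u \<and> (\<forall>x\<in>U. x \<le> w \<longrightarrow> x = w)"
proof -
  obtain w where w: "w \<in> U \<and> w \<le> u"
    and least: "\<And>x. x \<in> U \<and> x \<le> u \<Longrightarrow> sum w UNIV \<le> sum x UNIV"
    using ex_has_least_nat[of "\<lambda>x. x \<in> U \<and> x \<le> u" u "\<lambda>x. sum x UNIV"] assms by auto
  have "x = w" if x: "x \<in> U" "x \<le> w" for x
  proof (rule ccontr)
    assume "x \<noteq> w"
    then have "sum x UNIV < sum w UNIV" by (rule sum_strict_mono_exponent[OF x(2)])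
    moreover have "x \<le> u" by (rule order_trans[OF x(2)]) (use w in blast)
    ultimately show False using least[of x] x(1) by simp
  qed
  with w show ?thesis by blast
qed

lemma finite_exponents_of_degree:
  "finite {a :: 'v::finite \<Rightarrow> nat. sum a UNIV = d}"
proof (rule finite_subset)
  show "{a :: 'v \<Rightarrow> nat. sum a UNIV = d} \<subseteq> {a. \<forall>v. a v \<le> d}"
  proof safe
    fix a :: "'v \<Rightarrow> nat" and v
    show "a v \<le> sum a UNIV" by (rule member_le_sum) simp_all
  qed
  show "finite {a :: 'v \<Rightarrow> nat. \<forall>v. a v \<le> d}"
    using finite_set_of_finite_funs[of "UNIV :: 'v set" "{..d}" undefined] by simp
qed

lemma sum_exchange:
  fixes v :: "'v::finite \<Rightarrow> nat"
  assumes "r \<noteq> s" "0 < v r"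
  shows "sum (v(r := v r - 1, s := v s + 1)) UNIV = sum v UNIV"
proof -
  have eq: "(UNIV :: 'v set) = insert r (insert s (UNIV - {r, s}))" by blast
  show ?thesis
    by (subst (1 2) eq) (use assms in simp)
qed

lemma degree_component_supported:
  fixes U :: "('v::finite \<Rightarrow> nat) set"
  assumes "up_closed U"
  shows "degree_component_ideal (supported U :: ('v, 'k::comm_ring_1) mpoly set) d =
    supported (up_closure {a \<in> U. sum a UNIV = d})"
proof
  have "a \<in> up_closure {a \<in> U. sum a UNIV = d}" if "a \<in> U" "sum a UNIV = d" for a
    unfolding up_closure_def by (intro CollectI bexI[of _ a] order_refl) (simp add: that)
  then have "{f \<in> supported U. homogeneous d f} \<subseteq>
      (supported (up_closure {a \<in> U. sum a UNIV = d}) :: ('v, 'k) mpoly set)"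
    by (simp add: homogeneous_iff_supported supported_def subset_iff)
  then show "degree_component_ideal (supported U) d \<subseteq>
      (supported (up_closure {a \<in> U. sum a UNIV = d}) :: ('v, 'k) mpoly set)"
    unfolding degree_component_ideal_def ideal_gen_def
    by (rule ring_module.span_minimal) (rule subspace_supported[OF up_closed_up_closure])
  have "monomial ` {a \<in> U. sum a UNIV = d} \<subseteq>
      {f \<in> (supported U :: ('v, 'k) mpoly set). homogeneous d f}"
    by (auto simp: homogeneous_iff_supported intro: monomial_in_supported)
  then show "(supported (up_closure {a \<in> U. sum a UNIV = d}) :: ('v, 'k) mpoly set) \<subseteq>
      degree_component_ideal (supported U) d"
    unfolding degree_component_ideal_def ideal_gen_monomials[symmetric] ideal_gen_def
    by (rule ring_module.span_mono)
qed

text \<open>Here \<open>F\<close> consists of the minimal exponents.  They lie in \<open>A\<close> and so are finitely many.\<close>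

theorem exchange_imp_linear_quotients:
  fixes U :: "('v::finite \<Rightarrow> nat) set"
  assumes rank: "inj rank" and exchange: "exchange_property rank U"
    and A: "finite A" "U = up_closure A"
  shows "has_linear_quotients (supported U :: ('v, 'k::comm_ring_1) mpoly set)"
proof -
  define F where "F = {v \<in> U. \<forall>w\<in>U. w \<le> v \<longrightarrow> w = v}"
  have "A \<subseteq> U" using A(2) by (auto simp: up_closure_def)
  then have "F \<subseteq> A"
    using A(2) by (auto simp: F_def up_closure_def)
  then have "finite F" using A(1) finite_subset by blast
  moreover have "F \<subseteq> U" by (auto simp: F_def)
  moreover have "u = v" if "u \<in> F" "v \<in> F" "u \<le> v" for u v
    using that by (simp add: F_def)
  moreover have below: "\<exists>w\<in>F. w \<le> u" if "u \<in> U" for u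
    using minimal_exponent_below[OF that] by (auto simp: F_def)
  ultimately obtain as where as: "set as = F" "variable_quotients as"
    by (rule exchange_imp_variable_quotients[OF rank exchange, of F]) blast+
  have "up_closure F = U"
  proof
    show "up_closure F \<subseteq> U"
      using \<open>F \<subseteq> U\<close> up_closed_up_closure[of A] A(2) unfolding up_closure_def[of F] up_closed_def by blast
    show "U \<subseteq> up_closure F" using below by (auto simp: up_closure_def)
  qed
  then show ?thesis
    using variable_quotients_imp_has_linear_quotients[OF as(2)] as(1) by simp
qed

text \<open>Here \<open>F\<close> consists of all exponents of degree \<open>d\<close>.  The exchange does not change the degree, so
  no step down to a smaller element of \<open>F\<close> is needed.\<close>

theorem exchange_imp_componentwise_linear:
  fixes U :: "('v::finite \<Rightarrow> nat) set"
  assumes rank: "inj rank" and exchange: "exchange_property rank U" and U: "up_closed U"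
  shows "componentwise_linear (supported U :: ('v, 'k::comm_ring_1) mpoly set)"
  unfolding componentwise_linear_def
proof
  fix d
  let ?F = "{a \<in> U. sum a UNIV = d}"
  have "finite ?F"
    using finite_exponents_of_degree[of d] by (rule rev_finite_subset) blast
  moreover have "?F \<subseteq> U" by blast
  moreover have "u = v" if "u \<in> ?F" "v \<in> ?F" "u \<le> v" for u v
    using sum_strict_mono_exponent[OF that(3)] that(1,2) by auto
  moreover have "\<exists>w\<in>?F. w \<le> v(r := v r - 1, s := v s + 1)"
    if "v \<in> ?F" "r \<noteq> s" "0 < v r" "v(r := v r - 1, s := v s + 1) \<in> U" for v r s
    using that sum_exchange[of r s v] by (intro bexI[where x = "v(r := v r - 1, s := v s + 1)"]) simp_all
  ultimately obtain as where "set as = ?F" "variable_quotients as"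
    by (rule exchange_imp_variable_quotients[OF rank exchange])
  then have "has_linear_resolution (supported (up_closure ?F) :: ('v, 'k) mpoly set)"
    using variable_quotients_imp_linear_resolution[of as d] by simp
  then show "has_linear_resolution (degree_component_ideal (supported U :: ('v, 'k) mpoly set) d)"
    by (simp add: degree_component_supported[OF U])
qed

section \<open>Powers of vertex cover ideals\<close>

definition indicator_exp :: "'v set \<Rightarrow> 'v \<Rightarrow> nat" where
  "indicator_exp C v = (if v \<in> C then 1 else 0)"

text \<open>The exponents of products of \<open>k\<close> squarefree monomials that come from vertex covers.  Covers
  that are not minimal are allowed, which does not change the ideal.\<close>

definition cover_sums :: "'v set set \<Rightarrow> nat \<Rightarrow> ('v \<Rightarrow> nat) set" where
  "cover_sums E k = {\<lambda>v. card {j. j < k \<and> v \<in> C j} | C. \<forall>j<k. vertex_cover E (C j)}"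

lemma prod_var: "(\<Prod>v\<in>C. var v) = (monomial (indicator_exp C) :: ('v::finite, 'k::comm_ring_1) mpoly)"
proof (induction C rule: finite_induct[OF finite])
  case 1
  have "Abs_poly_mapping (indicator_exp {}) = (0 :: 'v \<Rightarrow>\<^sub>0 nat)"
    by (rule poly_mapping_eqI) (simp add: indicator_exp_def)
  then show ?case by (simp add: monomial_def)
next
  case (2 x C)
  have "(\<lambda>v. unit_exp x v + indicator_exp C v) = indicator_exp (insert x C)"
    using 2 by (intro ext) (simp add: unit_exp_def indicator_exp_def)
  then show ?case using 2 by (simp add: var_eq_monomial monomial_mult)
qed

lemma minimal_vertex_cover_below:
  fixes C :: "'v::finite set"
  assumes "vertex_cover E C"
  shows "\<exists>D. minimal_vertex_cover E D \<and> D \<subseteq> C"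
  using assms
proof (induction C rule: finite_psubset_induct[OF finite])
  case (1 C)
  show ?case
  proof (cases "minimal_vertex_cover E C")
    case True
    then show ?thesis by blast
  next
    case False
    then obtain D where "D \<subset> C" "vertex_cover E D"
      using 1(3) by (auto simp: minimal_vertex_cover_def)
    then show ?thesis using 1(2)[of D] by blast
  qed
qed

lemma vertex_cover_ideal_eq:
  "vertex_cover_ideal E =
    (supported (up_closure (indicator_exp ` {C. vertex_cover E C})) :: ('v::finite, 'k::comm_ring_1) mpoly set)"
proof -
  have "up_closure (indicator_exp ` {C. minimal_vertex_cover E C}) = up_closure (indicator_exp ` {C. vertex_cover E C})"
  proof (intro equalityI subsetI)
    fix a assume "a \<in> up_closure (indicator_exp ` {C. minimal_vertex_cover E C})"
    then show "a \<in> up_closure (indicator_exp ` {C. vertex_cover E C})"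
      by (auto simp: up_closure_def minimal_vertex_cover_def)
  next
    fix a assume "a \<in> up_closure (indicator_exp ` {C. vertex_cover E C})"
    then obtain C where C: "vertex_cover E C" "indicator_exp C \<le> a" by (auto simp: up_closure_def)
    obtain D where D: "minimal_vertex_cover E D" "D \<subseteq> C"
      using minimal_vertex_cover_below[OF C(1)] by blast
    have "indicator_exp D \<le> indicator_exp C" using D(2) by (auto simp: le_fun_def indicator_exp_def)
    then have "indicator_exp D \<le> a" using C(2) by (rule order_trans)
    then show "a \<in> up_closure (indicator_exp ` {C. minimal_vertex_cover E C})"
      using D(1) by (auto simp: up_closure_def)
  qed
  moreover have "{\<Prod>v\<in>C. var v | C. minimal_vertex_cover E C} =
      (monomial ` indicator_exp ` {C. minimal_vertex_cover E C} :: ('v, 'k) mpoly set)"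
    by (auto simp: prod_var)
  ultimately show ?thesis
    by (simp add: vertex_cover_ideal_def ideal_gen_monomials)
qed

lemma ideal_mult_supported:
  fixes A B :: "('v::finite \<Rightarrow> nat) set"
  shows "ideal_mult (supported (up_closure A)) (supported (up_closure B)) =
    (supported (up_closure {\<lambda>v. a v + b v | a b. a \<in> A \<and> b \<in> B}) :: ('v, 'k::comm_ring_1) mpoly set)"
    (is "ideal_mult ?I ?J = supported (up_closure ?S)")
proof
  have "f * g \<in> supported (up_closure ?S)" if "f \<in> ?I" "g \<in> ?J" for f g
    using that
  proof (rule supported_mult)
    fix a b assume "a \<in> up_closure A" "b \<in> up_closure B"
    then obtain a' b' where "a' \<in> A" "a' \<le> a" "b' \<in> B" "b' \<le> b"
      unfolding up_closure_def by (elim CollectE bexE)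
    moreover from this have "(\<lambda>v. a' v + b' v) \<le> (\<lambda>v. a v + b v)"
      by (simp add: le_fun_def add_mono)
    ultimately show "(\<lambda>v. a v + b v) \<in> up_closure ?S"
      unfolding up_closure_def by blast
  qed
  then have "{f * g | f g. f \<in> ?I \<and> g \<in> ?J} \<subseteq> supported (up_closure ?S)" by blast
  then show "ideal_mult ?I ?J \<subseteq> supported (up_closure ?S)"
    unfolding ideal_mult_def ideal_gen_def
    by (rule ring_module.span_minimal) (rule subspace_supported[OF up_closed_up_closure])
  have "monomial ` ?S \<subseteq> {f * g | f g. f \<in> ?I \<and> g \<in> ?J}"
  proof
    fix p :: "('v, 'k) mpoly" assume "p \<in> monomial ` ?S"
    then obtain a b where ab: "p = monomial (\<lambda>v. a v + b v)" "a \<in> A" "b \<in> B" by blast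
    have "monomial a \<in> ?I" "monomial b \<in> ?J"
      using ab(2,3) by (auto intro!: monomial_in_supported simp: up_closure_def)
    moreover have "p = monomial a * monomial b" by (simp add: ab(1) monomial_mult)
    ultimately show "p \<in> {f * g | f g. f \<in> ?I \<and> g \<in> ?J}" by blast
  qed
  then show "supported (up_closure ?S) \<subseteq> ideal_mult ?I ?J"
    unfolding ideal_mult_def ideal_gen_monomials[symmetric] ideal_gen_def
    by (rule ring_module.span_mono)
qed

lemma cover_sums_Suc:
  "cover_sums E (Suc k) = {\<lambda>v. a v + b v | a b. a \<in> indicator_exp ` {C. vertex_cover E C} \<and> b \<in> cover_sums E k}"
proof -
  have card_Suc: "card {j. j < Suc k \<and> v \<in> C j} = indicator_exp (C k) v + card {j. j < k \<and> v \<in> C j}" for C v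
  proof -
    have "{j. j < Suc k \<and> v \<in> C j} = (if v \<in> C k then insert k else id) {j. j < k \<and> v \<in> C j}"
      by (auto simp: less_Suc_eq)
    then show ?thesis by (simp add: indicator_exp_def)
  qed
  show ?thesis
  proof (intro equalityI subsetI)
    fix a assume "a \<in> cover_sums E (Suc k)"
    then obtain C where C: "a = (\<lambda>v. card {j. j < Suc k \<and> v \<in> C j})" "\<forall>j<Suc k. vertex_cover E (C j)"
      by (auto simp: cover_sums_def)
    have "(\<lambda>v. card {j. j < k \<and> v \<in> C j}) \<in> cover_sums E k"
      using C(2) by (auto simp: cover_sums_def)
    moreover have "indicator_exp (C k) \<in> indicator_exp ` {C. vertex_cover E C}" using C(2) by simp
    ultimately show "a \<in> {\<lambda>v. a v + b v | a b. a \<in> indicator_exp ` {C. vertex_cover E C} \<and> b \<in> cover_sums E k}"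
      unfolding C(1) card_Suc
      by (intro CollectI exI[where x = "indicator_exp (C k)"] exI[where x = "\<lambda>v. card {j. j < k \<and> v \<in> C j}"])
        simp
  next
    fix a assume "a \<in> {\<lambda>v. a v + b v | a b. a \<in> indicator_exp ` {C. vertex_cover E C} \<and> b \<in> cover_sums E k}"
    then obtain D C where a: "a = (\<lambda>v. indicator_exp D v + card {j. j < k \<and> v \<in> C j})"
      and D: "vertex_cover E D" and C: "\<forall>j<k. vertex_cover E (C j)"
      by (auto simp: cover_sums_def)
    have "{j. j < k \<and> v \<in> (C(k := D)) j} = {j. j < k \<and> v \<in> C j}" for v by auto
    then have "a = (\<lambda>v. card {j. j < Suc k \<and> v \<in> (C(k := D)) j})"
      unfolding a card_Suc by simp
    moreover have "\<forall>j<Suc k. vertex_cover E ((C(k := D)) j)" using C D by (simp add: less_Suc_eq)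
    ultimately show "a \<in> cover_sums E (Suc k)" unfolding cover_sums_def by blast
  qed
qed

theorem power_vertex_cover_ideal:
  "ideal_power (vertex_cover_ideal E) k =
    (supported (up_closure (cover_sums E k)) :: ('v::finite, 'k::comm_ring_1) mpoly set)"
proof (induction k)
  case 0
  have "up_closure (cover_sums E 0) = UNIV"
    by (auto simp: up_closure_def cover_sums_def le_fun_def)
  then show ?case by (simp add: supported_def)
next
  case (Suc k)
  then show ?case
    by (simp only: ideal_power.simps vertex_cover_ideal_eq ideal_mult_supported cover_sums_Suc)
qed

lemma finite_cover_sums: "finite (cover_sums (E :: 'v::finite set set) k)"
proof (rule finite_subset)
  show "cover_sums E k \<subseteq> {a. \<forall>v. a v \<le> k}"
  proof
    fix a assume "a \<in> cover_sums E k"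
    then obtain C where a: "a = (\<lambda>v. card {j. j < k \<and> v \<in> C j})" by (auto simp: cover_sums_def)
    have "card {j. j < k \<and> v \<in> C j} \<le> card {..<k}" for v by (rule card_mono) auto
    then show "a \<in> {a. \<forall>v. a v \<le> k}" by (simp add: a)
  qed
  show "finite {a :: 'v \<Rightarrow> nat. \<forall>v. a v \<le> k}"
    using finite_set_of_finite_funs[of "UNIV :: 'v set" "{..k}" undefined] by simp
qed

section \<open>Clique deficits and a criterion for graphs\<close>

definition clique :: "'v set set \<Rightarrow> 'v set \<Rightarrow> bool" where
  "clique E W \<longleftrightarrow> (\<forall>u\<in>W. \<forall>v\<in>W. u \<noteq> v \<longrightarrow> {u, v} \<in> E)"

text \<open>What \<open>a\<close> lacks to the constant exponent \<open>k\<close> on \<open>W\<close>.  The subtraction is that of natural numbers: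
  vertices with exponent at least \<open>k\<close> have no deficit.\<close>

definition deficit :: "nat \<Rightarrow> ('v \<Rightarrow> nat) \<Rightarrow> 'v set \<Rightarrow> nat" where
  "deficit k a W = (\<Sum>v\<in>W. k - a v)"

definition clique_bounded :: "'v set set \<Rightarrow> nat \<Rightarrow> ('v \<Rightarrow> nat) set" where
  "clique_bounded E k = {a. \<forall>W. clique E W \<longrightarrow> deficit k a W \<le> k}"

lemma deficit_antimono: "a \<le> b \<Longrightarrow> deficit k b W \<le> deficit k a W"
  unfolding deficit_def by (intro sum_mono diff_le_mono2) (rule le_funD)

lemma deficit_subset: "W \<subseteq> W' \<Longrightarrow> deficit k a W \<le> deficit k a W'"
  for W' :: "'v::finite set"
  unfolding deficit_def by (intro sum_mono2) simp_all

lemma deficit_remove: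
  fixes W :: "'v::finite set"
  shows "t \<in> W \<Longrightarrow> deficit k a W = (k - a t) + deficit k a (W - {t})"
  unfolding deficit_def by (rule sum.remove) simp_all

lemma deficit_upd_notin: "t \<notin> W \<Longrightarrow> deficit k (a(t := c)) W = deficit k a W"
  unfolding deficit_def by (rule sum.cong) auto

lemma deficit_lower:
  fixes W :: "'v::finite set"
  assumes "0 < a t"
  shows "deficit k (a(t := a t - 1)) W = deficit k a W + (if t \<in> W \<and> a t \<le> k then 1 else 0)"
proof (cases "t \<in> W")
  case True
  have "deficit k (a(t := a t - 1)) W = (k - (a t - 1)) + deficit k a (W - {t})"
    using deficit_remove[OF True, of k "a(t := a t - 1)"] by (simp add: deficit_upd_notin)
  then show ?thesis using deficit_remove[OF True, of k a] assms True by auto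
qed (simp add: deficit_upd_notin)

lemma deficit_raise:
  fixes W :: "'v::finite set"
  assumes "s \<in> W" "a s < k"
  shows "Suc (deficit k (a(s := a s + 1)) W) = deficit k a W"
proof -
  have "deficit k (a(s := a s + 1)) W = (k - (a s + 1)) + deficit k a (W - {s})"
    using deficit_remove[OF assms(1), of k "a(s := a s + 1)"] by (simp add: deficit_upd_notin)
  then show ?thesis using deficit_remove[OF assms(1), of k a] assms by simp
qed

lemma up_closed_clique_bounded: "up_closed (clique_bounded E k)"
  unfolding up_closed_def clique_bounded_def
  using deficit_antimono order_trans by blast

text \<open>A vertex cover misses at most one vertex of a clique, so \<open>k\<close> vertex covers miss the vertices
  of a clique at most \<open>k\<close> times altogether, counted with multiplicity.\<close>

lemma cover_sums_subset_clique_bounded: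
  fixes E :: "'v::finite set set"
  shows "up_closure (cover_sums E k) \<subseteq> clique_bounded E k"
proof -
  have "cover_sums E k \<subseteq> clique_bounded E k"
  proof
    fix a assume "a \<in> cover_sums E k"
    then obtain C where a: "a = (\<lambda>v. card {j. j < k \<and> v \<in> C j})"
      and C: "\<And>j. j < k \<Longrightarrow> vertex_cover E (C j)"
      by (auto simp: cover_sums_def)
    have "deficit k a W \<le> k" if W: "clique E W" for W
    proof -
      have "deficit k a W = (\<Sum>v\<in>W. card {j \<in> {..<k}. v \<notin> C j})"
        unfolding deficit_def
      proof (rule sum.cong[OF refl])
        fix v
        have "{j \<in> {..<k}. v \<notin> C j} = {..<k} - {j. j < k \<and> v \<in> C j}" by auto
        moreover have "card ({..<k} - {j. j < k \<and> v \<in> C j}) = card {..<k} - card {j. j < k \<and> v \<in> C j}"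
          by (rule card_Diff_subset) auto
        ultimately show "k - a v = card {j \<in> {..<k}. v \<notin> C j}" by (simp add: a)
      qed
      also have "\<dots> = (\<Sum>j<k. card {v \<in> W. v \<notin> C j})"
        by (rule sum_multicount_gen) simp_all
      also have "\<dots> \<le> (\<Sum>j<k. 1)"
      proof (rule sum_mono)
        fix j assume "j \<in> {..<k}"
        then have cover: "vertex_cover E (C j)" using C by simp
        have "u = v" if "u \<in> W" "u \<notin> C j" "v \<in> W" "v \<notin> C j" for u v
        proof (rule ccontr)
          assume "u \<noteq> v"
          then have "{u, v} \<in> E" using W that by (simp add: clique_def)
          then have "{u, v} \<inter> C j \<noteq> {}" using cover unfolding vertex_cover_def by blast
          then show False using that by simp
        qed
        then show "card {v \<in> W. v \<notin> C j} \<le> 1"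
          by (subst card_le_Suc0_iff_eq[unfolded One_nat_def[symmetric]]) auto
      qed
      finally show ?thesis by simp
    qed
    then show "a \<in> clique_bounded E k" by (simp add: clique_bounded_def)
  qed
  then show ?thesis
    using up_closed_clique_bounded[of E k] unfolding up_closure_def up_closed_def by blast
qed

definition later_neighbours :: "('v \<Rightarrow> nat) \<Rightarrow> 'v set set \<Rightarrow> 'v \<Rightarrow> 'v set" where
  "later_neighbours rank E t = {x. {t, x} \<in> E \<and> rank t < rank x}"

text \<open>A vertex \<open>x\<close> in the closed neighbourhood of \<open>t\<close> does not distinguish the later neighbours of
  \<open>t\<close>: it is equal or adjacent to all of them or to none.  With \<open>x = y\<close> this says that the later
  neighbours form a clique.\<close>

definition later_neighbours_homogeneous :: "('v \<Rightarrow> nat) \<Rightarrow> 'v set set \<Rightarrow> 'v \<Rightarrow> bool" where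
  "later_neighbours_homogeneous rank E t \<longleftrightarrow>
    (\<forall>x. \<forall>y\<in>later_neighbours rank E t. \<forall>z\<in>later_neighbours rank E t.
      (x = t \<or> {t, x} \<in> E) \<and> (x = y \<or> {x, y} \<in> E) \<longrightarrow> x = z \<or> {x, z} \<in> E)"

text \<open>The leaf \<open>l\<close> attached to \<open>t\<close> precedes \<open>t\<close>.\<close>

definition has_earlier_leaf :: "('v \<Rightarrow> nat) \<Rightarrow> 'v set set \<Rightarrow> 'v \<Rightarrow> bool" where
  "has_earlier_leaf rank E t \<longleftrightarrow> (\<exists>l. rank l < rank t \<and> {l, t} \<in> E \<and> (\<forall>x. {l, x} \<in> E \<longrightarrow> x = t))"

lemma clique_union_later_neighbours:
  assumes hom: "later_neighbours_homogeneous rank E t"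
    and M: "clique E M" "t \<in> M" "y \<in> M" "y \<in> later_neighbours rank E t"
  shows "clique E (M \<union> later_neighbours rank E t)"
proof -
  let ?N = "later_neighbours rank E t"
  have MN: "{x, z} \<in> E" if "x \<in> M" "z \<in> ?N" "x \<noteq> z" for x z
    using hom M that unfolding later_neighbours_homogeneous_def clique_def by metis
  have NN: "{x, z} \<in> E" if "x \<in> ?N" "z \<in> ?N" "x \<noteq> z" for x z
    using hom that unfolding later_neighbours_homogeneous_def
    by (metis (no_types, lifting) later_neighbours_def mem_Collect_eq)
  show ?thesis
    unfolding clique_def
  proof (intro ballI impI)
    fix u v assume "u \<in> M \<union> ?N" "v \<in> M \<union> ?N" "u \<noteq> v"
    then show "{u, v} \<in> E"
      using M(1) MN[of u v] MN[of v u] NN[of u v] by (auto simp: clique_def insert_commute)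
  qed
qed

text \<open>Let \<open>t\<close> be the first place where \<open>u\<close> and \<open>v\<close> differ, so that \<open>u t < v t\<close>.  If \<open>v t\<close> can be
  lowered by one, then any \<open>s\<close> with \<open>v s < u s\<close> may be raised.  Otherwise the deficits of \<open>v\<close> add up
  to \<open>k\<close> on some clique through \<open>t\<close>; call such a clique tight.  On a tight clique \<open>u\<close> has no larger
  total deficit but a larger deficit at \<open>t\<close>, so at some other vertex \<open>s\<close> its deficit is smaller,
  and \<open>s\<close> comes after \<open>t\<close>.

  If the later neighbours of \<open>t\<close> are homogeneous, one such \<open>s\<close> lies in all tight cliques through
  \<open>t\<close>: a tight clique contains some later neighbour, hence can be enlarged by all of them, and
  therefore already contains those with positive deficit.  So the unit at \<open>t\<close> can be moved to
  \<open>s\<close>.  If instead \<open>t\<close> has an earlier leaf \<open>l\<close>, then \<open>u l = v l\<close>, and \<open>u t < v t\<close> makes the edge between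
  \<open>l\<close> and \<open>t\<close>, the only maximal clique through \<open>l\<close>, slack for \<open>v\<close>.  So \<open>v l\<close> can be lowered
  instead.\<close>

lemma clique_bounded_exchange:
  fixes E :: "'v::finite set set"
  assumes rank: "inj rank"
    and graph: "\<And>t. later_neighbours_homogeneous rank E t \<or> has_earlier_leaf rank E t"
  shows "exchange_property rank (clique_bounded E k)"
  unfolding exchange_property_def
proof (intro ballI impI)
  let ?U = "clique_bounded E k"
  fix u v assume u: "u \<in> ?U" and v: "v \<in> ?U" and uv: "lex_less rank u v \<and> \<not> u \<le> v"
  obtain t where t: "u t < v t" and eq: "\<And>s. rank s < rank t \<Longrightarrow> u s = v s"
    using uv by (auto simp: lex_less_def)
  have later: "rank t < rank s" if "v s < u s" for s
  proof (rule ccontr)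
    assume "\<not> rank t < rank s"
    then have "rank s < rank t \<or> s = t" using injD[OF rank, of s t] by linarith
    then show False using eq[of s] t that by auto
  qed
  obtain s0 where s0: "v s0 < u s0" using uv by (auto simp: le_fun_def not_le)
  have drop: "\<exists>r s. rank r < rank s \<and> v s < u s \<and> 0 < v r \<and> v(r := v r - 1, s := v s + 1) \<in> ?U"
    if r: "rank r \<le> rank t" "0 < v r" "v(r := v r - 1) \<in> ?U" for r
  proof (intro exI conjI)
    show "rank r < rank s0" using r(1) later[OF s0] by simp
    then have "r \<noteq> s0" by blast
    then have "v(r := v r - 1) \<le> v(r := v r - 1, s0 := v s0 + 1)" by (simp add: le_fun_def)
    then show "v(r := v r - 1, s0 := v s0 + 1) \<in> ?U"
      using r(3) up_closed_clique_bounded[of E k] unfolding up_closed_def by blast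
  qed (use s0 r in auto)
  show "\<exists>r s. rank r < rank s \<and> v s < u s \<and> 0 < v r \<and> v(r := v r - 1, s := v s + 1) \<in> ?U"
  proof (cases "v(t := v t - 1) \<in> ?U")
    case True
    then show ?thesis using drop[of t] t by simp
  next
    case False
    then obtain M where M: "clique E M" "k < deficit k (v(t := v t - 1)) M"
      by (auto simp: clique_bounded_def not_le)
    have vt_pos: "0 < v t" using t by simp
    have M_le: "deficit k v M \<le> k" using v M(1) by (simp add: clique_bounded_def)
    have tM: "t \<in> M" and vt: "v t \<le> k" and M_tight: "deficit k v M = k"
      using M(2) M_le deficit_lower[of v t k M] vt_pos by (auto split: if_splits)
    \<comment> \<open>Every tight clique through \<open>t\<close> has a later neighbour of \<open>t\<close> where \<open>v\<close> lacks more than \<open>u\<close>.\<close>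
    have tight_partner: "\<exists>s\<in>M'. s \<in> later_neighbours rank E t \<and> v s < u s \<and> v s < k"
      if M': "clique E M'" "t \<in> M'" "deficit k v M' = k" for M'
    proof -
      have "\<exists>s\<in>M'. k - u s < k - v s"
      proof (rule ccontr)
        assume "\<not> (\<exists>s\<in>M'. k - u s < k - v s)"
        then have "\<forall>s\<in>M'. k - v s \<le> k - u s" by (auto simp: not_less)
        moreover have "\<exists>s\<in>M'. k - v s < k - u s" using M'(2) t vt by (intro bexI[of _ t]) simp_all
        ultimately have "deficit k v M' < deficit k u M'"
          unfolding deficit_def by (intro sum_strict_mono_ex1) simp_all
        moreover have "deficit k u M' \<le> k" using u M'(1) by (simp add: clique_bounded_def)
        ultimately show False using M'(3) by simp
      qed
      then obtain s where s: "s \<in> M'" "v s < u s" "v s < k" by auto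
      have "s \<noteq> t" using s(2) t by auto
      then have "{t, s} \<in> E" using M'(1,2) s(1) by (simp add: clique_def)
      then show ?thesis using s later[OF s(2)] by (auto simp: later_neighbours_def)
    qed
    show ?thesis
    proof (cases "later_neighbours_homogeneous rank E t")
      case hom: True
      obtain s where s: "s \<in> later_neighbours rank E t" "v s < u s" "v s < k"
        using tight_partner[OF M(1) tM M_tight] by blast
      have st: "s \<noteq> t" using s(2) t by auto
      let ?w = "v(t := v t - 1, s := v s + 1)"
      have "deficit k ?w M' \<le> k" if M': "clique E M'" for M'
      proof -
        have bound: "deficit k v M' \<le> k" using v M' by (simp add: clique_bounded_def)
        have low: "deficit k (v(t := v t - 1)) M' = deficit k v M' + (if t \<in> M' then 1 else 0)"
          using deficit_lower[of v t k M'] vt vt_pos by simp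
        consider "s \<in> M'" | "s \<notin> M'" "t \<notin> M'" | "s \<notin> M'" "t \<in> M'" by blast
        then show ?thesis
        proof cases
          case 1
          then show ?thesis
            using deficit_raise[of s M' "v(t := v t - 1)" k] st s(3) low bound
            by (simp split: if_splits)
        next
          case 2
          then show ?thesis using bound low by (simp add: deficit_upd_notin)
        next
          case 3
          have "deficit k v M' \<noteq> k"
          proof
            assume tight: "deficit k v M' = k"
            then obtain y where "y \<in> M'" "y \<in> later_neighbours rank E t"
              using tight_partner[OF M' 3(2)] by blast
            then have "clique E (M' \<union> later_neighbours rank E t)"
              using clique_union_later_neighbours[OF hom M' 3(2)] by blast
            then have "deficit k v (M' \<union> later_neighbours rank E t) \<le> k"
              using v by (simp add: clique_bounded_def)
            moreover have "deficit k v (insert s M') \<le> deficit k v (M' \<union> later_neighbours rank E t)"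
              using s(1) by (intro deficit_subset) blast
            moreover have "deficit k v (insert s M') = (k - v s) + deficit k v M'"
              using 3(1) by (simp add: deficit_def)
            ultimately show False using tight s(3) by simp
          qed
          then show ?thesis using bound low 3 by (simp add: deficit_upd_notin)
        qed
      qed
      then have w: "?w \<in> ?U" by (simp add: clique_bounded_def)
      show ?thesis
      proof (intro exI conjI)
        show "rank t < rank s" by (rule later[OF s(2)])
      qed (fact s(2) vt_pos w)+
    next
      case False
      then obtain l where l: "rank l < rank t" "{l, t} \<in> E" "\<And>x. {l, x} \<in> E \<Longrightarrow> x = t"
        using graph[of t] unfolding has_earlier_leaf_def by blast
      have lt: "l \<noteq> t" using l(1) by blast
      have "clique E {l, t}" using l(2) by (auto simp: clique_def insert_commute)
      then have "deficit k u {l, t} \<le> k" using u by (simp add: clique_bounded_def)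
      then have slack: "(k - v l) + (k - v t) < k"
        using eq[OF l(1)] t vt lt by (simp add: deficit_def)
      then have vl: "0 < v l" by (cases "v l = 0") auto
      have "deficit k (v(l := v l - 1)) M' \<le> k" if M': "clique E M'" for M'
      proof (cases "l \<in> M'")
        case True
        then have "M' \<subseteq> {l, t}" using M' l(3) by (auto simp: clique_def)
        then have "deficit k (v(l := v l - 1)) M' \<le> deficit k (v(l := v l - 1)) {l, t}"
          by (rule deficit_subset)
        also have "\<dots> \<le> k" using slack lt vl by (simp add: deficit_def)
        finally show ?thesis .
      next
        case False
        then show ?thesis using v M' by (simp add: deficit_upd_notin clique_bounded_def)
      qed
      then have "v(l := v l - 1) \<in> ?U" by (simp add: clique_bounded_def)
      then show ?thesis using drop[of l] l(1) vl by simp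
    qed
  qed
qed

text \<open>The last hypothesis, the converse of the inclusion proved above, is a form of perfection of
  the graph: deficits whose sums over cliques are at most \<open>k\<close> are covered by the \<open>k\<close> complements of
  vertex covers, which are independent sets.\<close>

theorem powers_criterion:
  fixes E :: "'v::finite set set"
  assumes "inj rank"
    and "\<And>t. later_neighbours_homogeneous rank E t \<or> has_earlier_leaf rank E t"
    and "clique_bounded E k \<subseteq> up_closure (cover_sums E k)"
  shows "has_linear_quotients (ideal_power (vertex_cover_ideal E :: ('v, 'k::comm_ring_1) mpoly set) k) \<and>
    componentwise_linear (ideal_power (vertex_cover_ideal E :: ('v, 'k) mpoly set) k)"
proof -
  have eq: "clique_bounded E k = up_closure (cover_sums E k)"
    using assms(3) cover_sums_subset_clique_bounded by blast
  have "exchange_property rank (clique_bounded E k)"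
    using assms(1,2) by (rule clique_bounded_exchange)
  then show ?thesis
    unfolding power_vertex_cover_ideal eq[symmetric]
    using exchange_imp_linear_quotients[OF assms(1) _ finite_cover_sums eq]
      exchange_imp_componentwise_linear[OF assms(1) _ up_closed_clique_bounded] by blast
qed

section \<open>Path graphs\<close>

lemma edge_deficit:
  fixes E :: "'v::finite set set"
  assumes "a \<in> clique_bounded E k" "{x, y} \<in> E" "x \<noteq> y"
  shows "(k - a x) + (k - a y) \<le> k"
proof -
  have "clique E {x, y}" using assms(2) by (auto simp: clique_def insert_commute)
  then have "deficit k a {x, y} \<le> k" using assms(1) by (simp add: clique_bounded_def)
  then show ?thesis using assms(3) by (simp add: deficit_def)
qed

lemma cover_sums_closureI:
  assumes "\<And>j. j < k \<Longrightarrow> vertex_cover E (C j)"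
    and "\<And>v. card {j. j < k \<and> v \<in> C j} \<le> a v"
  shows "a \<in> up_closure (cover_sums E k)"
  unfolding up_closure_def cover_sums_def using assms by (auto simp: le_fun_def)

lemma card_initial: "card {j. j < k \<and> j < c} \<le> (c :: nat)"
  by (rule order_trans[OF card_mono[of "{..<c}"]]) auto

lemma card_final: "card {j. j < k \<and> k - c \<le> j} \<le> (c :: nat)"
  by (rule order_trans[OF card_mono[of "{k - c..<k}"]]) auto

text \<open>Along the path a vertex has at most one later neighbour.  To split an exponent into covers,
  two-colour the path by parity: a vertex of one colour goes to the first \<open>a v\<close> covers and a
  vertex of the other colour to the last \<open>a v\<close> ones.  The bound on the deficits of an edge says
  that these two ranges exhaust the \<open>k\<close> covers.\<close>

lemma path_graph_power:
  fixes E :: "'v::finite set set"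
  assumes "path_graph E"
  shows "has_linear_quotients (ideal_power (vertex_cover_ideal E :: ('v, 'k::comm_ring_1) mpoly set) k) \<and>
    componentwise_linear (ideal_power (vertex_cover_ideal E :: ('v, 'k) mpoly set) k)"
proof -
  obtain n :: nat and f where f: "bij_betw f {1..n} (UNIV :: 'v set)"
    and E: "E = {{f i, f (i + 1)} | i. 1 \<le> i \<and> i < n}"
    using assms unfolding path_graph_def by blast
  define g where "g = inv_into {1..n} f"
  have g: "g (f i) = i" if "1 \<le> i" "i \<le> n" for i
    unfolding g_def using f that by (intro inv_into_f_f) (auto simp: bij_betw_def)
  have "inj g"
    unfolding g_def using bij_betw_inv_into[OF f] by (simp add: bij_betw_def)
  have E_g: "g y = Suc (g x) \<or> g x = Suc (g y)" if xy: "{x, y} \<in> E" for x y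
  proof -
    obtain i where "{x, y} = {f i, f (i + 1)}" "1 \<le> i" "i < n" using xy E by blast
    then show ?thesis using g[of i] g[of "i + 1"] by (auto simp: doubleton_eq_iff)
  qed
  have "later_neighbours_homogeneous g E t" for t
  proof -
    have "y = z" if "y \<in> later_neighbours g E t" "z \<in> later_neighbours g E t" for y z
    proof -
      have "g y = Suc (g t)" "g z = Suc (g t)"
        using that E_g[of t y] E_g[of t z] by (auto simp: later_neighbours_def)
      then show ?thesis using injD[OF \<open>inj g\<close>, of y z] by simp
    qed
    then show ?thesis unfolding later_neighbours_homogeneous_def by metis
  qed
  moreover have "clique_bounded E k \<subseteq> up_closure (cover_sums E k)"
  proof
    fix a assume a: "a \<in> clique_bounded E k"
    define C where "C j = {x. if even (g x) then j < a x else k - a x \<le> j}" for j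
    show "a \<in> up_closure (cover_sums E k)"
    proof (rule cover_sums_closureI)
      fix j assume j: "j < k"
      show "vertex_cover E (C j)"
        unfolding vertex_cover_def
      proof
        fix e assume "e \<in> E"
        then obtain x y where e: "e = {x, y}" "{x, y} \<in> E" unfolding E by blast
        have xy: "even (g x) \<noteq> even (g y)" using E_g[OF e(2)] by auto
        then have "x \<noteq> y" by blast
        then have "(k - a x) + (k - a y) \<le> k" by (rule edge_deficit[OF a e(2)])
        then have "x \<in> C j \<or> y \<in> C j" using xy j by (auto simp: C_def)
        then show "e \<inter> C j \<noteq> {}" by (auto simp: e(1))
      qed
    next
      fix v
      show "card {j. j < k \<and> v \<in> C j} \<le> a v"
        by (cases "even (g v)") (simp_all add: C_def card_initial card_final)
    qed
  qed
  ultimately show ?thesis using powers_criterion[OF \<open>inj g\<close>] by blast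
qed

section \<open>Biclique graphs\<close>

text \<open>Only a rough order between groups of vertices matters for the remaining two families; ties
  are broken arbitrarily.\<close>

lemma rank_refining_level:
  fixes level :: "'v::finite \<Rightarrow> nat"
  shows "\<exists>rank :: 'v \<Rightarrow> nat. inj rank \<and> (\<forall>x y. rank x < rank y \<longrightarrow> level x \<le> level y)"
proof -
  obtain e :: "'v \<Rightarrow> nat" and N where e: "e ` UNIV = {i. i < N}" "inj e"
    using finite_imp_inj_to_nat_seg[of "UNIV :: 'v set"] by auto
  have e_less: "e x < N" for x using e(1) by blast
  define rank where "rank x = level x * N + e x" for x
  have less: "rank x < rank y" if "level x < level y" for x y
  proof -
    have "rank x < Suc (level x) * N" using e_less[of x] by (simp add: rank_def)
    also have "\<dots> \<le> level y * N" using that by (intro mult_le_mono1) simp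
    also have "\<dots> \<le> rank y" by (simp add: rank_def)
    finally show ?thesis .
  qed
  have "inj rank"
  proof (rule injI)
    fix x y assume xy: "rank x = rank y"
    then have "level x = level y" using less[of x y] less[of y x] by linarith
    then show "x = y" using xy injD[OF e(2)] by (simp add: rank_def)
  qed
  moreover have "level x \<le> level y" if "rank x < rank y" for x y
    using less[of y x] that by linarith
  ultimately show ?thesis by blast
qed

lemma list_with_multiplicities:
  fixes d :: "'v \<Rightarrow> nat"
  assumes "finite W"
  shows "\<exists>xs. set xs \<subseteq> W \<and> length xs = sum d W \<and> (\<forall>v\<in>W. d v \<le> card {j. j < length xs \<and> xs ! j = v})"
  using assms
proof (induction W)
  case empty
  then show ?case by simp
next
  case (insert w W)
  then obtain xs where xs: "set xs \<subseteq> W" "length xs = sum d W"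
    "\<And>v. v \<in> W \<Longrightarrow> d v \<le> length (filter (\<lambda>x. x = v) xs)"
    by (auto simp: length_filter_conv_card)
  have "set (xs @ replicate (d w) w) \<subseteq> insert w W" using xs(1) by (auto split: if_splits)
  moreover have "length (xs @ replicate (d w) w) = sum d (insert w W)"
    using insert xs(2) by simp
  moreover have "d v \<le> length (filter (\<lambda>x. x = v) (xs @ replicate (d w) w))" if "v \<in> insert w W" for v
    using that xs(3)[of v] by (cases "v = w") auto
  ultimately show ?case unfolding length_filter_conv_card by blast
qed

lemma complete_edges_iff: "{u, v} \<in> complete_edges W \<longleftrightarrow> u \<in> W \<and> v \<in> W \<and> u \<noteq> v"
proof
  assume "{u, v} \<in> complete_edges W"
  then obtain x y where "{u, v} = {x, y}" "x \<in> W" "y \<in> W" "x \<noteq> y"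
    unfolding complete_edges_def by blast
  then show "u \<in> W \<and> v \<in> W \<and> u \<noteq> v" unfolding doubleton_eq_iff by blast
next
  assume "u \<in> W \<and> v \<in> W \<and> u \<noteq> v"
  then show "{u, v} \<in> complete_edges W" unfolding complete_edges_def by blast
qed

text \<open>The common part \<open>X\<close> of the two cliques is placed last.  Then the later neighbours of a vertex
  of \<open>X\<close> lie in \<open>X\<close>, whose elements are adjacent to everything, and a vertex of \<open>Y\<close> or of \<open>Z\<close> lies in
  a single maximal clique.

  To split an exponent into covers, list the vertices of \<open>X\<close>, \<open>Y\<close> and \<open>Z\<close> with their deficits as
  multiplicities.  The \<open>j\<close>-th cover omits the \<open>j\<close>-th entries of \<open>xs @ ys\<close> and of \<open>xs @ zs\<close>: these
  are one and the same vertex of \<open>X\<close>, or at most one vertex of \<open>Y\<close> and one of \<open>Z\<close>.  Both lists have length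
  at most \<open>k\<close> by the bound on the deficits of the two cliques, so every deficit is used up.\<close>

lemma biclique_graph_power:
  fixes E :: "'v::finite set set"
  assumes "biclique_graph E"
  shows "has_linear_quotients (ideal_power (vertex_cover_ideal E :: ('v, 'k::comm_ring_1) mpoly set) k) \<and>
    componentwise_linear (ideal_power (vertex_cover_ideal E :: ('v, 'k) mpoly set) k)"
proof -
  obtain X Y Z where disj: "X \<inter> Y = {}" "X \<inter> Z = {}" "Y \<inter> Z = {}"
    and all: "X \<union> Y \<union> Z = (UNIV :: 'v set)"
    and E: "E = complete_edges (X \<union> Y) \<union> complete_edges (X \<union> Z)"
    using assms unfolding biclique_graph_def by blast
  have adj: "{u, v} \<in> E \<longleftrightarrow> u \<noteq> v \<and> (u \<in> X \<union> Y \<and> v \<in> X \<union> Y \<or> u \<in> X \<union> Z \<and> v \<in> X \<union> Z)" for u v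
    unfolding E Un_iff[of "{u, v}"] complete_edges_iff by blast
  define level :: "'v \<Rightarrow> nat" where "level v = (if v \<in> X then 1 else 0)" for v
  obtain rank :: "'v \<Rightarrow> nat" where rank: "inj rank" "\<And>x y. rank x < rank y \<Longrightarrow> level x \<le> level y"
    using rank_refining_level[of level] by auto
  have "later_neighbours_homogeneous rank E t" for t
    unfolding later_neighbours_homogeneous_def
  proof (intro allI ballI impI)
    fix x y z
    assume y: "y \<in> later_neighbours rank E t" and z: "z \<in> later_neighbours rank E t"
      and x: "(x = t \<or> {t, x} \<in> E) \<and> (x = y \<or> {x, y} \<in> E)"
    have "t \<in> X \<Longrightarrow> z \<in> X"
      using z rank(2)[of t z] by (auto simp: later_neighbours_def level_def split: if_splits)
    moreover have "x = t \<or> {t, x} \<in> E" "{t, z} \<in> E"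
      using x z by (simp_all add: later_neighbours_def)
    moreover have "\<not> (x \<in> X \<and> x \<in> Y)" "\<not> (x \<in> X \<and> x \<in> Z)" "\<not> (x \<in> Y \<and> x \<in> Z)"
      "\<not> (t \<in> X \<and> t \<in> Y)" "\<not> (t \<in> X \<and> t \<in> Z)" "\<not> (t \<in> Y \<and> t \<in> Z)"
      using disj by auto
    ultimately show "x = z \<or> {x, z} \<in> E"
      unfolding adj by auto
  qed
  moreover have "clique_bounded E k \<subseteq> up_closure (cover_sums E k)"
  proof
    fix a assume a: "a \<in> clique_bounded E k"
    let ?d = "\<lambda>v. k - a v"
    obtain xs where xs: "set xs \<subseteq> X" "length xs = sum ?d X"
      "\<And>v. v \<in> X \<Longrightarrow> ?d v \<le> card {j. j < length xs \<and> xs ! j = v}"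
      using list_with_multiplicities[of X ?d] by auto
    obtain ys where ys: "set ys \<subseteq> Y" "length ys = sum ?d Y"
      "\<And>v. v \<in> Y \<Longrightarrow> ?d v \<le> card {j. j < length ys \<and> ys ! j = v}"
      using list_with_multiplicities[of Y ?d] by auto
    obtain zs where zs: "set zs \<subseteq> Z" "length zs = sum ?d Z"
      "\<And>v. v \<in> Z \<Longrightarrow> ?d v \<le> card {j. j < length zs \<and> zs ! j = v}"
      using list_with_multiplicities[of Z ?d] by auto
    have "clique E (X \<union> Y)" "clique E (X \<union> Z)" by (auto simp: clique_def adj)
    then have "deficit k a (X \<union> Y) \<le> k" "deficit k a (X \<union> Z) \<le> k"
      using a by (simp_all add: clique_bounded_def)
    then have len: "length (xs @ ys) \<le> k" "length (xs @ zs) \<le> k"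
      using disj xs(2) ys(2) zs(2) by (simp_all add: deficit_def sum.union_disjoint)
    define missed where "missed L j v \<longleftrightarrow> j < length L \<and> L ! j = v" for L :: "'v list" and j v
    define C where "C j = {v. \<not> missed (xs @ ys) j v \<and> \<not> missed (xs @ zs) j v}" for j
    have missed_xs: "missed (xs @ us) j v" if "missed xs j v" for us j v
      using that by (auto simp: missed_def nth_append)
    have count_append: "?d v \<le> card {j. missed (xs @ us) j v}"
      if "?d v \<le> card {j. missed us j v}" for us v
    proof -
      have "(\<lambda>j. length xs + j) ` {j. missed us j v} \<subseteq> {j. missed (xs @ us) j v}"
        by (auto simp: missed_def)
      moreover have "finite {j. missed (xs @ us) j v}"
        by (rule finite_subset[of _ "{..<length (xs @ us)}"]) (auto simp: missed_def)
      ultimately have "card ((\<lambda>j. length xs + j) ` {j. missed us j v}) \<le> card {j. missed (xs @ us) j v}"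
        by (rule card_mono[rotated])
      then show ?thesis using that by (simp add: card_image inj_on_def)
    qed
    show "a \<in> up_closure (cover_sums E k)"
    proof (rule cover_sums_closureI)
      fix j assume j: "j < k"
      show "vertex_cover E (C j)"
        unfolding vertex_cover_def
      proof
        fix e assume e: "e \<in> E"
        then obtain u v where uv: "e = {u, v}" unfolding E complete_edges_def by blast
        have in_Y: "w \<in> Y" if "missed (xs @ ys) j w" "\<not> j < length xs" for w
          using that ys(1) nth_mem[of "j - length xs" ys] by (auto simp: missed_def nth_append)
        have in_Z: "w \<in> Z" if "missed (xs @ zs) j w" "\<not> j < length xs" for w
          using that zs(1) nth_mem[of "j - length xs" zs] by (auto simp: missed_def nth_append)
        have "u \<in> C j \<or> v \<in> C j"
        proof (rule ccontr)
          assume "\<not> (u \<in> C j \<or> v \<in> C j)"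
          then have m: "missed (xs @ ys) j u \<or> missed (xs @ zs) j u"
            "missed (xs @ ys) j v \<or> missed (xs @ zs) j v" by (auto simp: C_def)
          show False
          proof (cases "j < length xs")
            case True
            then have "u = v" using m by (auto simp: missed_def nth_append)
            then show False using e adj[of u v] by (simp add: uv)
          next
            case False
            have "u \<noteq> v" using e adj[of u v] by (simp add: uv)
            then have "u \<in> Y \<and> v \<in> Z \<or> u \<in> Z \<and> v \<in> Y"
              using m in_Y[OF _ False] in_Z[OF _ False] by (auto simp: missed_def)
            then show False using e adj[of u v] disj by (auto simp: uv)
          qed
        qed
        then show "e \<inter> C j \<noteq> {}" by (auto simp: uv)
      qed
    next
      fix v
      have fin: "finite {j. missed L j v}" for L
        by (rule finite_subset[of _ "{..<length L}"]) (auto simp: missed_def)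
      have "?d v \<le> card {j \<in> {..<k}. v \<notin> C j}"
      proof -
        have sub: "{j. missed (xs @ ys) j v} \<subseteq> {j \<in> {..<k}. v \<notin> C j}"
          "{j. missed (xs @ zs) j v} \<subseteq> {j \<in> {..<k}. v \<notin> C j}"
          using len by (auto simp: missed_def C_def)
        consider "v \<in> X" | "v \<in> Y" | "v \<in> Z" using all by blast
        then have "?d v \<le> card {j. missed (xs @ ys) j v} \<or> ?d v \<le> card {j. missed (xs @ zs) j v}"
        proof cases
          case 1
          have "card {j. missed xs j v} \<le> card {j. missed (xs @ ys) j v}"
            using missed_xs by (intro card_mono fin) blast
          then show ?thesis using xs(3)[OF 1] by (simp add: missed_def)
        next
          case 2
          then show ?thesis using count_append[of v ys] ys(3) by (simp add: missed_def)
        next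
          case 3
          then show ?thesis using count_append[of v zs] zs(3) by (simp add: missed_def)
        qed
        then show ?thesis
          using card_mono[OF _ sub(1)] card_mono[OF _ sub(2)] by force
      qed
      moreover have "card {j. j < k \<and> v \<in> C j} = k - card {j \<in> {..<k}. v \<notin> C j}"
      proof -
        have "{j. j < k \<and> v \<in> C j} = {..<k} - {j \<in> {..<k}. v \<notin> C j}" by auto
        moreover have "card ({..<k} - {j \<in> {..<k}. v \<notin> C j}) = card {..<k} - card {j \<in> {..<k}. v \<notin> C j}"
          by (rule card_Diff_subset) auto
        ultimately show ?thesis by simp
      qed
      ultimately show "card {j. j < k \<and> v \<in> C j} \<le> a v" by linarith
    qed
  qed
  ultimately show ?thesis using powers_criterion[OF rank(1)] by blast
qed

section \<open>Cameron--Walker graphs over a complete bipartite graph\<close>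

text \<open>The order is: leaves, tips of the triangles, \<open>V1\<close>, \<open>V2\<close>.  A leaf has one neighbour, a tip
  lies in a single maximal clique (its triangle), a vertex of \<open>V2\<close> has no later neighbour, and a
  vertex of \<open>V1\<close> has an earlier leaf.

  To split an exponent into covers, proceed as for a bipartite graph with \<open>V2\<close> and the leaves
  on one side: these vertices go to the first covers and those of \<open>V1\<close> to the last ones.  In
  each triangle one tip, \<open>pick e\<close>, goes to the last covers too, and the other tip goes to the
  covers that avoid \<open>pick e\<close> or the base \<open>b e\<close>.  The bound on the deficits of the triangle limits their
  number.\<close>

lemma cameron_walker_graph_power:
  fixes E :: "'v::finite set set"
  assumes "cameron_walker_graph V1 V2 (complete_bipartite_edges V1 V2) E"
  shows "has_linear_quotients (ideal_power (vertex_cover_ideal E :: ('v, 'k::comm_ring_1) mpoly set) k) \<and>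
    componentwise_linear (ideal_power (vertex_cover_ideal E :: ('v, 'k) mpoly set) k)"
proof -
  have V12: "V1 \<inter> V2 = {}"
    using assms by (simp add: cameron_walker_graph_def connected_bipartite_def)
  obtain L h P b where disj: "(V1 \<union> V2) \<inter> L = {}" "(V1 \<union> V2) \<inter> \<Union>P = {}" "L \<inter> \<Union>P = {}"
    and all: "V1 \<union> V2 \<union> L \<union> \<Union>P = UNIV" and h: "h ` L = V1"
    and P_all: "\<forall>e\<in>P. card e = 2 \<and> b e \<in> V2" and P_disj: "pairwise disjnt P"
    and E: "E = complete_bipartite_edges V1 V2 \<union> {{h l, l} | l. l \<in> L} \<union> P \<union> {{b e, w} | e w. e \<in> P \<and> w \<in> e}"
    using assms unfolding cameron_walker_graph_def by (elim conjE exE)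
  have P: "card e = 2" "b e \<in> V2" if "e \<in> P" for e using P_all that by auto
  have P_unique: "e = e'" if "e \<in> P" "e' \<in> P" "x \<in> e" "x \<in> e'" for e e' x
    using P_disj that unfolding pairwise_def disjnt_def by blast
  have P_pair: "e = {x, y}" if "e \<in> P" "x \<in> e" "y \<in> e" "x \<noteq> y" for e x y
  proof -
    have "finite e" using P(1)[OF that(1)] card.infinite by fastforce
    then show ?thesis using P(1)[OF that(1)] that card_seteq[of e "{x, y}"] by simp
  qed
  define level :: "'v \<Rightarrow> nat" where
    "level v = (if v \<in> V2 then 3 else if v \<in> V1 then 2 else if v \<in> L then 0 else 1)" for v
  obtain rank :: "'v \<Rightarrow> nat" where rank: "inj rank" "\<And>x y. rank x < rank y \<Longrightarrow> level x \<le> level y"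
    using rank_refining_level[of level] by auto
  have in_L: "x \<notin> V1 \<and> x \<notin> V2 \<and> x \<notin> \<Union>P" if "x \<in> L" for x using disj that by blast
  have in_P: "x \<notin> V1 \<and> x \<notin> V2 \<and> x \<notin> L" if "x \<in> e" "e \<in> P" for x e using disj that by blast
  have h_V1: "h l \<in> V1" if "l \<in> L" for l using h that by blast
  have E_cases: "(\<exists>u v. e = {u, v} \<and> u \<in> V1 \<and> v \<in> V2) \<or> (\<exists>l. e = {h l, l} \<and> l \<in> L) \<or> e \<in> P \<or>
      (\<exists>e' w. e = {b e', w} \<and> e' \<in> P \<and> w \<in> e')" if "e \<in> E" for e
    using that unfolding E complete_bipartite_edges_def Un_iff mem_Collect_eq by argo
  have edge: "w \<in> V1 \<and> x \<in> V2 \<or> w \<in> V2 \<and> x \<in> V1 \<or> w \<in> L \<and> x = h w \<or> x \<in> L \<and> w = h x \<or> {w, x} \<in> P \<or>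
      (\<exists>e\<in>P. w = b e \<and> x \<in> e) \<or> (\<exists>e\<in>P. x = b e \<and> w \<in> e)"
    if "{w, x} \<in> E" for w x
    using E_cases[OF that] unfolding doubleton_eq_iff by blast
  have P_set: "x \<in> \<Union>P" if "{w, x} \<in> P \<or> {x, w} \<in> P \<or> (\<exists>e\<in>P. x \<in> e)" for w x using that by blast
  have leaf: "x = h l" if "l \<in> L" "{l, x} \<in> E" for l x
    using edge[OF that(2)] in_L[OF that(1)] in_L[of x] h_V1[of x] P(2) P_set[of x l] P_set[of l x]
    by (auto simp: insert_commute)
  have tip: "x \<in> insert (b e) e" if we: "w \<in> e" "e \<in> P" and wx: "{w, x} \<in> E" for w e x
  proof -
    have "x \<in> L \<Longrightarrow> w \<noteq> h x" using in_P[OF we] h_V1 by blast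
    then consider "{w, x} \<in> P" | e' where "e' \<in> P" "x = b e'" "w \<in> e'"
      using edge[OF wx] in_P[OF we] P(2) by blast
    then show ?thesis
    proof cases
      case 1
      then have "{w, x} = e" using P_unique[of "{w, x}" e w] we by simp
      then show ?thesis by blast
    next
      case 2
      then show ?thesis using P_unique[of e e' w] we by simp
    qed
  qed
  have triangle: "{x, y} \<in> E" if xy: "e \<in> P" "x \<in> insert (b e) e" "y \<in> insert (b e) e" "x \<noteq> y" for e x y
  proof -
    consider "x = b e" "y \<in> e" | "y = b e" "x \<in> e" | "x \<in> e" "y \<in> e" using xy by blast
    then show ?thesis
    proof cases
      case 1
      then show ?thesis using xy(1) unfolding E by blast
    next
      case 2
      then have "{y, x} \<in> E" using xy(1) unfolding E by blast
      then show ?thesis by (simp add: insert_commute)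
    next
      case 3
      then have "{x, y} = e" using P_pair xy by blast
      then show ?thesis using xy(1) unfolding E by blast
    qed
  qed
  have no_V2_edge: "\<not> (x \<in> V2 \<and> y \<in> V2)" if "{x, y} \<in> E" for x y
  proof
    assume xy: "x \<in> V2 \<and> y \<in> V2"
    then have "x \<notin> V1" "y \<notin> V1" "x \<notin> L" "y \<notin> L" using V12 in_L by blast+
    moreover have notin: "x \<notin> e \<and> y \<notin> e" if "e \<in> P" for e using xy in_P that by blast
    moreover have "{x, y} \<notin> P" using notin[of "{x, y}"] by blast
    ultimately show False using edge[OF that] by simp
  qed
  have "later_neighbours_homogeneous rank E t \<or> has_earlier_leaf rank E t" for t
  proof -
    consider "t \<in> V1" | "t \<in> V2" | "t \<in> L" | e where "e \<in> P" "t \<in> e" using all by blast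
    then show ?thesis
    proof cases
      case 1
      then obtain l where l: "l \<in> L" "h l = t" using h by blast
      have "level l < level t" using 1 l in_L[OF l(1)] V12 by (auto simp: level_def)
      moreover from this have "l \<noteq> t" by blast
      ultimately have "rank l < rank t"
        using rank(2)[of t l] injD[OF rank(1), of l t] by linarith
      moreover have "{l, t} \<in> E" using l unfolding E by (auto simp: insert_commute)
      ultimately have "has_earlier_leaf rank E t"
        unfolding has_earlier_leaf_def using leaf[OF l(1)] l(2) by blast
      then show ?thesis by blast
    next
      case 2
      have "later_neighbours rank E t = {}"
      proof -
        have "x \<in> V2" if "rank t < rank x" for x
          using rank(2)[OF that] 2 by (auto simp: level_def split: if_splits)
        then show ?thesis using 2 no_V2_edge[of t] by (auto simp: later_neighbours_def)
      qed
      then show ?thesis by (simp add: later_neighbours_homogeneous_def)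
    next
      case 3
      have "y = z" if "y \<in> later_neighbours rank E t" "z \<in> later_neighbours rank E t" for y z
        using leaf[OF 3, of y] leaf[OF 3, of z] that by (simp add: later_neighbours_def)
      then show ?thesis unfolding later_neighbours_homogeneous_def by metis
    next
      case (4 e)
      have "x = z \<or> {x, z} \<in> E"
        if "z \<in> later_neighbours rank E t" "x = t \<or> {t, x} \<in> E" for x z
      proof -
        have "x \<in> insert (b e) e" "z \<in> insert (b e) e"
          using that 4 tip[OF 4(2,1)] by (auto simp: later_neighbours_def)
        then show ?thesis using triangle[OF 4(1)] by blast
      qed
      then show ?thesis unfolding later_neighbours_homogeneous_def by blast
    qed
  qed
  moreover have "clique_bounded E k \<subseteq> up_closure (cover_sums E k)"
  proof
    fix a assume a: "a \<in> clique_bounded E k"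
    define pick where "pick e = (SOME x. x \<in> e)" for e :: "'v set"
    have pick: "pick e \<in> e" if "e \<in> P" for e
      unfolding pick_def by (rule someI_ex) (use P(1)[OF that] in \<open>auto simp: card_2_iff\<close>)
    define C where "C j = {v. (v \<in> V2 \<union> L \<and> j < a v) \<or> (v \<in> V1 \<union> pick ` P \<and> k - a v \<le> j) \<or>
      (\<exists>e\<in>P. v \<in> e \<and> v \<noteq> pick e \<and> (j < k - a (pick e) \<or> a (b e) \<le> j))}" for j
    have bound: "k - a x \<le> a y" if "{x, y} \<in> E" "x \<noteq> y" for x y
      using edge_deficit[OF a that] by linarith
    have base_tip: "{b e, w} \<in> E" "b e \<noteq> w" if "e \<in> P" "w \<in> e" for e w
    proof -
      show "{b e, w} \<in> E" using that unfolding E by blast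
      show "b e \<noteq> w" using P(2)[OF that(1)] in_P[OF that(2,1)] by blast
    qed
    show "a \<in> up_closure (cover_sums E k)"
    proof (rule cover_sums_closureI)
      fix j assume j: "j < k"
      show "vertex_cover E (C j)"
        unfolding vertex_cover_def
      proof
        fix e assume e: "e \<in> E"
        consider u v where "e = {u, v}" "u \<in> V1" "v \<in> V2"
          | l where "e = {h l, l}" "l \<in> L" | "e \<in> P"
          | e' w where "e = {b e', w}" "e' \<in> P" "w \<in> e'"
          using E_cases[OF e] by blast
        then show "e \<inter> C j \<noteq> {}"
        proof cases
          case 1
          then have "u \<noteq> v" using V12 by blast
          then have "k - a u \<le> a v" using bound[of u v] e 1(1) by simp
          then have "u \<in> C j \<or> v \<in> C j" using 1 by (auto simp: C_def)
          then show ?thesis by (auto simp: 1)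
        next
          case 2
          have "h l \<noteq> l" using h_V1[OF 2(2)] in_L[OF 2(2)] by metis
          then have "k - a (h l) \<le> a l" using bound[of "h l" l] e 2(1) by simp
          then have "h l \<in> C j \<or> l \<in> C j" using 2 h_V1 by (auto simp: C_def)
          then show ?thesis by (auto simp: 2)
        next
          case 3
          obtain q where q: "q \<in> e" "q \<noteq> pick e"
          proof -
            obtain x y where xy: "e = {x, y}" "x \<noteq> y" using P(1)[OF 3] unfolding card_2_iff by blast
            show ?thesis
            proof (cases "x = pick e")
              case True
              then show ?thesis using that[of y] xy by blast
            next
              case False
              then show ?thesis using that[of x] xy by blast
            qed
          qed
          have "pick e \<in> C j \<or> q \<in> C j"
          proof (cases "j < k - a (pick e)")
            case True
            then have "q \<in> C j" using 3 q unfolding C_def by blast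
            then show ?thesis ..
          next
            case False
            then have "pick e \<in> C j" using 3 by (simp add: C_def)
            then show ?thesis ..
          qed
          then show ?thesis using pick[OF 3] q(1) by blast
        next
          case 4
          show ?thesis
          proof (cases "j < a (b e')")
            case True
            then have "b e' \<in> C j" using P(2)[OF 4(2)] by (simp add: C_def)
            then show ?thesis by (auto simp: 4)
          next
            case False
            have "w \<in> C j"
            proof (cases "w = pick e'")
              case True
              have "k - a w \<le> a (b e')"
                using bound[of w "b e'"] base_tip[OF 4(2,3)] by (auto simp: insert_commute)
              then show ?thesis using True \<open>\<not> j < a (b e')\<close> 4(2) by (auto simp: C_def)
            next
              case False
              then show ?thesis using \<open>\<not> j < a (b e')\<close> 4 by (auto simp: C_def)
            qed
            then show ?thesis by (auto simp: 4)
          qed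
        qed
      qed
    next
      fix v
      consider "v \<in> V1" | "v \<in> V2" | "v \<in> L" | e where "e \<in> P" "v = pick e"
        | e where "e \<in> P" "v \<in> e" "v \<noteq> pick e"
        using all by blast
      then show "card {j. j < k \<and> v \<in> C j} \<le> a v"
      proof cases
        case 1
        have "v \<notin> V2" "v \<notin> L" "\<forall>e\<in>P. v \<notin> e" using 1 V12 in_L in_P by blast+
        then have "v \<in> C j \<longleftrightarrow> k - a v \<le> j" for j using 1 unfolding C_def by blast
        then show ?thesis by (simp add: card_final)
      next
        case 2
        have "v \<notin> V1" "\<forall>e\<in>P. v \<notin> e" using 2 V12 in_P by blast+
        moreover from this have "v \<notin> pick ` P" using pick by blast
        ultimately have "v \<in> C j \<longleftrightarrow> j < a v" for j using 2 unfolding C_def by blast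
        then show ?thesis by (simp add: card_initial)
      next
        case 3
        have "v \<notin> V1" "\<forall>e\<in>P. v \<notin> e" using 3 in_L in_P by blast+
        moreover from this have "v \<notin> pick ` P" using pick by blast
        ultimately have "v \<in> C j \<longleftrightarrow> j < a v" for j using 3 unfolding C_def by blast
        then show ?thesis by (simp add: card_initial)
      next
        case (4 e)
        have "v = pick e'" if "e' \<in> P" "v \<in> e'" for e'
          using P_unique[of e e' v] 4 pick[OF 4(1)] that by simp
        moreover have "v \<notin> V2" "v \<notin> L" using in_P[OF pick[OF 4(1)] 4(1)] 4(2) by simp_all
        ultimately have "v \<in> C j \<longleftrightarrow> k - a v \<le> j" for j using 4 unfolding C_def by blast
        then show ?thesis by (simp add: card_final)
      next
        case (5 e)
        have e: "e' = e" if "e' \<in> P" "v \<in> e'" for e'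
          using P_unique[of e' e v] 5 that by simp
        have "v \<notin> pick ` P" using e pick 5(3) by blast
        moreover have "v \<notin> V1" "v \<notin> V2" "v \<notin> L" using in_P[OF 5(2,1)] by simp_all
        ultimately have C: "v \<in> C j \<longleftrightarrow> j < k - a (pick e) \<or> a (b e) \<le> j" for j
          using e 5 unfolding C_def by blast
        have "card {j. j < k \<and> v \<in> C j} \<le> card ({..<k - a (pick e)} \<union> {a (b e)..<k})"
          by (rule card_mono) (auto simp: C)
        also have "\<dots> \<le> (k - a (pick e)) + (k - a (b e))"
          by (rule order_trans[OF card_Un_le]) simp
        also have "\<dots> \<le> a v"
        proof -
          have "clique E {b e, pick e, v}"
            using triangle[OF 5(1)] pick[OF 5(1)] 5(2) by (auto simp: clique_def)
          then have "deficit k a {b e, pick e, v} \<le> k" using a by (simp add: clique_bounded_def)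
          moreover have "b e \<noteq> pick e" "b e \<noteq> v"
            using base_tip(2)[OF 5(1) pick[OF 5(1)]] base_tip(2)[OF 5(1,2)] by auto
          ultimately show ?thesis using 5(3) by (simp add: deficit_def)
        qed
        finally show ?thesis .
      qed
    qed
  qed
  ultimately show ?thesis using powers_criterion[OF rank(1)] by blast
qed

theorem corollary4p7:
  fixes E :: "'v::finite set set"
  assumes "path_graph E \<or> biclique_graph E \<or>
    (\<exists>V1 V2. cameron_walker_graph V1 V2 (complete_bipartite_edges V1 V2) E)"
  shows "\<forall>k\<ge>1.
    has_linear_quotients (ideal_power (vertex_cover_ideal E :: ('v, 'k::field) mpoly set) k) \<and>
    componentwise_linear (ideal_power (vertex_cover_ideal E :: ('v, 'k) mpoly set) k)"
  using assms path_graph_power biclique_graph_power cameron_walker_graph_power by blast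

end
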